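(* Let $n,m$ be positive integers, let $G\in\mathcal{I}(n,m)$, and let $H$ be a finitely generated group with $G\approx H$, i.e. $\mathrm{Con}(G)=\mathrm{Con}(H)$. If $(n,m)=(3,2)$, or $(n,m)=(3,3)$, or $m=1$ (with $n$ arbitrary), then $G\cong H$.
   Context: Let $G$ be a finitely generated group. Given a finite generating sequence $\mathfrak g=(g_1,\dots,g_k)$ of $G$ and a finite (indexed) partition $\mathcal E=\{E_1,\dots,E_r\}$ of $G$ into nonempty, pairwise disjoint subsets, a configuration corresponding to $(\mathfrak g,\mathcal E)$ is a $(k+1)$-tuple $C=(c_0,c_1,\dots,c_k)$ with $1\le c_i\le r$ for each $i$ such that there is $x\in G$ with $x\in E_{c_0}$ and $g_ix\in E_{c_i}$ for each $1\le i\le k$. The set of all configurations corresponding to $(\mathfrak g,\mathcal E)$ is denoted $\mathrm{Con}(\mathfrak g,\mathcal E)$, and $\mathrm{Con}(G)$ denotes the set of all $\mathrm{Con}(\mathfrak g,\mathcal E)$ as $\mathfrak g$ runs over the finite generating sequences of $G$ and $\mathcal E$ over the finite partitions of $G$. Finitely generated groups $G_1,G_2$ are called configuration equivalent, written $G_1\approx G_2$, if $\mathrm{Con}(G_1)=\mathrm{Con}(G_2)$. For a finitely generated torsion-free nilpotent group $G$ of class $2$, $\tau(G)$ denotes the isolator of the commutator subgroup $G'$ in $G$, i.e. the set of all $x\in G$ such that $x^s\in G'$ for some nonzero integer $s$; it is a central subgroup of $G$, and $\tau(G)/G'$ is the torsion subgroup of $G/G'$. For positive integers $n,m$, $\mathcal{I}(n,m)$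 denotes the class of all finitely generated torsion-free nilpotent groups $G$ of class $2$ such that $G/\tau(G)\cong\mathbb{Z}^n$ and $\tau(G)\cong\mathbb{Z}^m$. *)

theory Defs
  imports "HOL-Algebra.Algebra" "HOL-Library.Disjoint_Sets"
begin

definition generating_seq :: "('a, 'b) monoid_scheme \<Rightarrow> 'a list \<Rightarrow> bool" where
  "generating_seq G gs \<longleftrightarrow> set gs \<subseteq> carrier G \<and> generate G (set gs) = carrier G"

definition finitely_generated :: "('a, 'b) monoid_scheme \<Rightarrow> bool" where
  "finitely_generated G \<longleftrightarrow> (\<exists>S. finite S \<and> S \<subseteq> carrier G \<and> generate G S = carrier G)"

text \<open>A partition \<open>{E\<^sub>1, \<dots>, E\<^sub>r}\<close> is a family indexed by \<open>{1..r}\<close>; the values of \<open>E\<close>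
  at other indices are irrelevant.\<close>

definition indexed_partition :: "('a, 'b) monoid_scheme \<Rightarrow> nat \<Rightarrow> (nat \<Rightarrow> 'a set) \<Rightarrow> bool" where
  "indexed_partition G r E \<longleftrightarrow>
     (\<forall>i\<in>{1..r}. E i \<noteq> {}) \<and> disjoint_family_on E {1..r} \<and> (\<Union>i\<in>{1..r}. E i) = carrier G"

text \<open>A tuple \<open>(c\<^sub>0, \<dots>, c\<^sub>k)\<close> is a list of length \<open>k + 1\<close>. The sequence \<open>(g\<^sub>1, \<dots>, g\<^sub>k)\<close> is a
  list numbered from 0, so \<open>g\<^bsub>i+1\<^esub>\<close> is \<open>gs ! i\<close>.\<close>

definition Con_pair ::
  "('a, 'b) monoid_scheme \<Rightarrow> 'a list \<Rightarrow> nat \<Rightarrow> (nat \<Rightarrow> 'a set) \<Rightarrow> nat list set" where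
  "Con_pair G gs r E =
     {c. length c = Suc (length gs) \<and> set c \<subseteq> {1..r} \<and>
         (\<exists>x\<in>carrier G. x \<in> E (c ! 0) \<and>
            (\<forall>i<length gs. gs ! i \<otimes>\<^bsub>G\<^esub> x \<in> E (c ! Suc i)))}"

definition Con :: "('a, 'b) monoid_scheme \<Rightarrow> nat list set set" where
  "Con G = {Con_pair G gs r E | gs r E. generating_seq G gs \<and> indexed_partition G r E}"

definition configuration_equivalent ::
  "('a, 'b) monoid_scheme \<Rightarrow> ('c, 'd) monoid_scheme \<Rightarrow> bool" where
  "configuration_equivalent G H \<longleftrightarrow> Con G = Con H"

definition torsion_free :: "('a, 'b) monoid_scheme \<Rightarrow> bool" where
  "torsion_free G \<longleftrightarrow> (\<forall>x\<in>carrier G. \<forall>k::nat. k > 0 \<and> x [^]\<^bsub>G\<^esub> k = \<one>\<^bsub>G\<^esub> \<longrightarrow> x = \<one>\<^bsub>G\<^esub>)"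

text \<open>The series is numbered from 0, so that the class is the least \<open>c\<close> with
  \<open>lower_central G c\<close> trivial, and \<open>lower_central G 1\<close> is the commutator subgroup.\<close>

fun lower_central :: "('a, 'b) monoid_scheme \<Rightarrow> nat \<Rightarrow> 'a set" where
  "lower_central G 0 = carrier G"
| "lower_central G (Suc i) =
     generate G {x \<otimes>\<^bsub>G\<^esub> y \<otimes>\<^bsub>G\<^esub> inv\<^bsub>G\<^esub> x \<otimes>\<^bsub>G\<^esub> inv\<^bsub>G\<^esub> y | x y. x \<in> lower_central G i \<and> y \<in> carrier G}"

definition nilpotent_of_class :: "('a, 'b) monoid_scheme \<Rightarrow> nat \<Rightarrow> bool" where
  "nilpotent_of_class G c \<longleftrightarrow>
     lower_central G c = {\<one>\<^bsub>G\<^esub>} \<and> (\<forall>i<c. lower_central G i \<noteq> {\<one>\<^bsub>G\<^esub>})"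

definition isolator :: "('a, 'b) monoid_scheme \<Rightarrow> 'a set \<Rightarrow> 'a set" where
  "isolator G K = {x \<in> carrier G. \<exists>s::int. s \<noteq> 0 \<and> x [^]\<^bsub>G\<^esub> s \<in> K}"

definition tau :: "('a, 'b) monoid_scheme \<Rightarrow> 'a set" where
  "tau G = isolator G (derived G (carrier G))"

definition int_power_group :: "nat \<Rightarrow> (nat \<Rightarrow> int) monoid" where
  "int_power_group n = product_group {..<n} (\<lambda>_. integer_group)"

definition class_I :: "nat \<Rightarrow> nat \<Rightarrow> ('a, 'b) monoid_scheme \<Rightarrow> bool" where
  "class_I n m G \<longleftrightarrow>
     group G \<and> finitely_generated G \<and> torsion_free G \<and> nilpotent_of_class G 2 \<and>
     G Mod (tau G) \<cong> int_power_group n \<and> G\<lparr>carrier := tau G\<rparr> \<cong> int_power_group m"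

end

theory Submission
  imports Defs "HOL-Library.Sublist"
begin

text \<open>A finite colouring in which finitely many elements of a group have a colour of their own transfers
  the fact that finitely many words are nontrivial; hence \<open>H\<close> satisfies every group law of \<open>G\<close> and
  is of class at most 2 as well. Such a group has a normal series with cyclic factors
  \<open>S\<^bsub>j+1\<^esub> / S\<^sub>j\<close> generated by \<open>g\<^sub>j\<close>. Colour \<open>x \<in> S\<^bsub>j+1\<^esub> - S\<^sub>j\<close> by \<open>j\<close> and by the sign of the exponent
  of \<open>g\<^sub>j\<close> in \<open>x\<close> (by the coset of \<open>S\<^sub>j\<close>, if the factor is finite): every \<open>x\<close> is reached from \<open>\<one>\<close>
  by a path along which each colour determines the next one. Refine this colouring so that a large
  ball around \<open>\<one>\<close> has singleton colours, and let \<open>h\<close> be the generating sequence of \<open>H\<close> with the same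
  configurations. The relators of \<open>g\<close>, read in the free class-2 group, form a finitely generated
  group, so if the ball is large, they all preserve the colour class of \<open>\<one>\<close> in \<open>H\<close>. If \<open>w(h) = \<one>\<close>,
  the path to \<open>w(g)\<close> leads in \<open>H\<close> from that class back into it, so \<open>w(g) = \<one>\<close>, and \<open>h\<^sub>i \<mapsto> g\<^sub>i\<close> is an
  epimorphism. By symmetry there is an epimorphism \<open>G \<rightarrow> H\<close>, and \<open>G\<close> is Hopfian.\<close>

section \<open>Words and colourings\<close>

text \<open>A letter \<open>(True, i)\<close> is the generator with index \<open>i\<close>, and
  \<open>(False, i)\<close> is its inverse. The first letter acts last, so the values of the
  suffixes of a word are the vertices of a path from the identity formed by left multiplications, as
  in a configuration.\<close>

primrec word_val :: "('a, 'b) monoid_scheme \<Rightarrow> 'a list \<Rightarrow> (bool \<times> nat) list \<Rightarrow> 'a" where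
  "word_val G gs [] = \<one>\<^bsub>G\<^esub>"
| "word_val G gs (l # w) =
     (if fst l then gs ! snd l else inv\<^bsub>G\<^esub> (gs ! snd l)) \<otimes>\<^bsub>G\<^esub> word_val G gs w"

definition words :: "nat \<Rightarrow> (bool \<times> nat) list set" where
  "words p = {w. set w \<subseteq> UNIV \<times> {..<p}}"

definition word_inv :: "(bool \<times> nat) list \<Rightarrow> (bool \<times> nat) list" where
  "word_inv w = rev (map (\<lambda>(b, i). (\<not> b, i)) w)"

lemma words_Nil [simp]: "[] \<in> words p"
  by (simp add: words_def)

lemma words_Cons [simp]: "l # w \<in> words p \<longleftrightarrow> snd l < p \<and> w \<in> words p"
  by (cases l) (auto simp: words_def)

lemma words_append [simp]: "v @ w \<in> words p \<longleftrightarrow> v \<in> words p \<and> w \<in> words p"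
  by (auto simp: words_def)

lemma word_inv_words [simp]: "w \<in> words p \<Longrightarrow> word_inv w \<in> words p"
  by (auto simp: words_def word_inv_def)

lemma word_inv_Cons: "word_inv (l # w) = word_inv w @ [(\<not> fst l, snd l)]"
  by (simp add: word_inv_def split_beta)

context group
begin

lemma nth_mem_carrier [simp]: "set gs \<subseteq> carrier G \<Longrightarrow> i < length gs \<Longrightarrow> gs ! i \<in> carrier G"
  by auto

lemma word_val_closed [simp]:
  "set gs \<subseteq> carrier G \<Longrightarrow> w \<in> words (length gs) \<Longrightarrow> word_val G gs w \<in> carrier G"
  by (induction w) auto

lemma word_val_append:
  "set gs \<subseteq> carrier G \<Longrightarrow> v \<in> words (length gs) \<Longrightarrow> w \<in> words (length gs) \<Longrightarrow>
   word_val G gs (v @ w) = word_val G gs v \<otimes> word_val G gs w"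
  by (induction v) (auto simp: m_assoc)

lemma word_val_inv:
  assumes "set gs \<subseteq> carrier G" "w \<in> words (length gs)"
  shows "word_val G gs (word_inv w) = inv (word_val G gs w)"
  using assms(2)
proof (induction w)
  case Nil
  then show ?case by (simp add: word_inv_def)
next
  case (Cons l w)
  have "gs ! snd l \<in> carrier G"
    using Cons.prems assms(1) by auto
  with Cons assms(1) show ?case
    by (auto simp: word_inv_Cons word_val_append inv_mult_group)
qed

lemma generate_eq_word_val:
  assumes "set gs \<subseteq> carrier G"
  shows "generate G (set gs) = word_val G gs ` words (length gs)"
proof (intro equalityI subsetI)
  fix x assume "x \<in> generate G (set gs)"
  then show "x \<in> word_val G gs ` words (length gs)"
  proof induction
    case one
    then show ?case by (intro image_eqI[of _ _ "[]"]) auto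
  next
    case (incl h)
    then obtain i where "i < length gs" "gs ! i = h" by (auto simp: in_set_conv_nth)
    with incl assms show ?case by (intro image_eqI[of _ _ "[(True, i)]"]) auto
  next
    case (inv h)
    then obtain i where "i < length gs" "gs ! i = h" by (auto simp: in_set_conv_nth)
    with inv assms show ?case by (intro image_eqI[of _ _ "[(False, i)]"]) auto
  next
    case (eng h1 h2)
    then obtain v w where "v \<in> words (length gs)" "w \<in> words (length gs)"
      "h1 = word_val G gs v" "h2 = word_val G gs w" by auto
    with assms show ?case by (intro image_eqI[of _ _ "v @ w"]) (auto simp: word_val_append)
  qed
next
  fix x assume "x \<in> word_val G gs ` words (length gs)"
  then obtain w where w: "w \<in> words (length gs)" and x: "x = word_val G gs w" by auto
  from w have "word_val G gs w \<in> generate G (set gs)"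
    by (induction w) (auto intro: generate.intros nth_mem)
  with x show "x \<in> generate G (set gs)" by simp
qed

end

section \<open>Configurations as colour patterns\<close>

lemma indexed_partition_index:
  assumes "indexed_partition G r E"
  obtains c where "\<And>x. x \<in> carrier G \<Longrightarrow> c x \<in> {1..r}"
    and "\<And>x i. x \<in> carrier G \<Longrightarrow> i \<in> {1..r} \<Longrightarrow> x \<in> E i \<longleftrightarrow> i = c x"
proof -
  have ex1: "\<exists>!i. i \<in> {1..r} \<and> x \<in> E i" if "x \<in> carrier G" for x
  proof -
    from that assms obtain i where i: "i \<in> {1..r}" "x \<in> E i"
      unfolding indexed_partition_def by blast
    moreover have "j = i" if "j \<in> {1..r}" "x \<in> E j" for j
      using assms i that unfolding indexed_partition_def disjoint_family_on_def by blast
    ultimately show ?thesis by blast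
  qed
  have c: "(THE i. i \<in> {1..r} \<and> x \<in> E i) \<in> {1..r} \<and> x \<in> E (THE i. i \<in> {1..r} \<and> x \<in> E i)"
    if "x \<in> carrier G" for x
    by (rule theI'[OF ex1[OF that]])
  show thesis
    by (rule that[of "\<lambda>x. THE i. i \<in> {1..r} \<and> x \<in> E i"]) (use c ex1 in blast)+
qed

text \<open>Since the blocks partition the group, every \<open>x\<close> has exactly one
  configuration: the colours of \<open>x\<close> and of its neighbours.\<close>

lemma Con_pair_eq_image:
  assumes "group G" "set gs \<subseteq> carrier G"
    and cr: "\<And>x. x \<in> carrier G \<Longrightarrow> c x \<in> {1..r}"
    and cE: "\<And>x i. x \<in> carrier G \<Longrightarrow> i \<in> {1..r} \<Longrightarrow> x \<in> E i \<longleftrightarrow> i = c x"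
  shows "Con_pair G gs r E = (\<lambda>x. c x # map (\<lambda>g. c (g \<otimes>\<^bsub>G\<^esub> x)) gs) ` carrier G"
proof -
  interpret group G by fact
  have gsc: "gs ! i \<in> carrier G" if "i < length gs" for i
    using that assms(2) by auto
  show ?thesis
  proof (intro equalityI subsetI)
    fix l assume "l \<in> Con_pair G gs r E"
    then obtain x where l: "length l = Suc (length gs)" "set l \<subseteq> {1..r}"
      and x: "x \<in> carrier G" "x \<in> E (l ! 0)"
        "\<And>i. i < length gs \<Longrightarrow> gs ! i \<otimes>\<^bsub>G\<^esub> x \<in> E (l ! Suc i)"
      by (auto simp: Con_pair_def)
    have lr: "l ! i \<in> {1..r}" if "i < Suc (length gs)" for i
      using l that by (metis nth_mem subsetD)
    have "l = c x # map (\<lambda>g. c (g \<otimes>\<^bsub>G\<^esub> x)) gs"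
    proof (rule nth_equalityI)
      fix i assume "i < length l"
      then show "l ! i = (c x # map (\<lambda>g. c (g \<otimes>\<^bsub>G\<^esub> x)) gs) ! i"
        using l(1) x lr[of i] cE[of x "l ! 0"] cE[of "gs ! (i - 1) \<otimes>\<^bsub>G\<^esub> x" "l ! i"] gsc[of "i - 1"]
        by (cases i) auto
    qed (use l in simp)
    with x show "l \<in> (\<lambda>x. c x # map (\<lambda>g. c (g \<otimes>\<^bsub>G\<^esub> x)) gs) ` carrier G" by blast
  next
    fix l assume "l \<in> (\<lambda>x. c x # map (\<lambda>g. c (g \<otimes>\<^bsub>G\<^esub> x)) gs) ` carrier G"
    then obtain x where x: "x \<in> carrier G" and l: "l = c x # map (\<lambda>g. c (g \<otimes>\<^bsub>G\<^esub> x)) gs" by blast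
    have "set l \<subseteq> {1..r}" using cr x assms(2) l by auto
    moreover have "x \<in> E (c x)" using cE[of x "c x"] cr x by blast
    moreover have "gs ! i \<otimes>\<^bsub>G\<^esub> x \<in> E (c (gs ! i \<otimes>\<^bsub>G\<^esub> x))" if "i < length gs" for i
      using cE[of "gs ! i \<otimes>\<^bsub>G\<^esub> x" "c (gs ! i \<otimes>\<^bsub>G\<^esub> x)"] cr x gsc[OF that] by blast
    ultimately show "l \<in> Con_pair G gs r E"
      using x by (auto simp: Con_pair_def l)
  qed
qed

text \<open>A common configuration set means that the same local colour patterns occur in both
  groups. The last two conclusions are the two inclusions between these sets of patterns.\<close>

lemma Con_colouring_transfer:
  fixes \<chi> :: "'a \<Rightarrow> 'k"
  assumes "group G" "group H" "Con G \<subseteq> Con H" "generating_seq G gs" "finite (\<chi> ` carrier G)"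
  obtains hs \<chi>' where "generating_seq H hs" "length hs = length gs"
    and "\<forall>x\<in>carrier G. \<exists>y\<in>carrier H. \<chi>' y = \<chi> x \<and>
           (\<forall>i<length gs. \<chi>' (hs ! i \<otimes>\<^bsub>H\<^esub> y) = \<chi> (gs ! i \<otimes>\<^bsub>G\<^esub> x))"
    and "\<forall>y\<in>carrier H. \<exists>x\<in>carrier G. \<chi>' y = \<chi> x \<and>
           (\<forall>i<length gs. \<chi>' (hs ! i \<otimes>\<^bsub>H\<^esub> y) = \<chi> (gs ! i \<otimes>\<^bsub>G\<^esub> x))"
proof -
  interpret G: group G by fact
  interpret H: group H by fact
  have gs: "set gs \<subseteq> carrier G" using assms(4) by (simp add: generating_seq_def)
  \<comment> \<open>\<open>f\<close> numbers the colours that occur, starting from 1, so that no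
    block \<open>E i\<close> is empty.\<close>
  obtain f where f: "bij_betw f {1..card (\<chi> ` carrier G)} (\<chi> ` carrier G)"
    using ex_bij_betw_nat_finite_1[OF assms(5)] by blast
  define r where "r = card (\<chi> ` carrier G)"
  define c where "c x = inv_into {1..r} f (\<chi> x)" for x
  define E where "E i = {x \<in> carrier G. \<chi> x = f i}" for i
  have f: "bij_betw f {1..r} (\<chi> ` carrier G)" using f by (simp add: r_def)
  have fc: "f (c x) = \<chi> x" and cr: "c x \<in> {1..r}" if "x \<in> carrier G" for x
  proof -
    have "\<chi> x \<in> f ` {1..r}" using f that by (auto simp: bij_betw_def)
    then show "f (c x) = \<chi> x" "c x \<in> {1..r}"
      unfolding c_def by (rule f_inv_into_f, rule inv_into_into)
  qed
  have cE: "x \<in> E i \<longleftrightarrow> i = c x" if "x \<in> carrier G" "i \<in> {1..r}" for x i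
    using that fc[of x] cr[of x] inj_onD[OF bij_betw_imp_inj_on[OF f], of i "c x"]
    by (auto simp: E_def)
  have "indexed_partition G r E"
    unfolding indexed_partition_def
  proof (intro conjI ballI)
    fix i assume "i \<in> {1..r}"
    then have "f i \<in> \<chi> ` carrier G" using f by (auto simp: bij_betw_def)
    then show "E i \<noteq> {}" by (auto simp: E_def)
  next
    have "x \<in> carrier G" if "x \<in> E i" for x i using that by (simp add: E_def)
    then show "disjoint_family_on E {1..r}"
      unfolding disjoint_family_on_def using cE by blast
    have "x \<in> E (c x)" if "x \<in> carrier G" for x using that fc by (simp add: E_def)
    then have "carrier G \<subseteq> (\<Union>i\<in>{1..r}. E i)" using cr by blast
    then show "(\<Union>i\<in>{1..r}. E i) = carrier G" by (auto simp: E_def)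
  qed
  then have "Con_pair G gs r E \<in> Con H"
    using assms(3,4) unfolding Con_def by blast
  then obtain hs s E' where hs: "generating_seq H hs" and E': "indexed_partition H s E'"
    and eq: "Con_pair G gs r E = Con_pair H hs s E'"
    unfolding Con_def by blast
  obtain c' where c': "\<And>x. x \<in> carrier H \<Longrightarrow> c' x \<in> {1..s}"
    "\<And>x i. x \<in> carrier H \<Longrightarrow> i \<in> {1..s} \<Longrightarrow> x \<in> E' i \<longleftrightarrow> i = c' x"
    using indexed_partition_index[OF E'] by blast
  have hsc: "set hs \<subseteq> carrier H" using hs by (simp add: generating_seq_def)
  have eq: "(\<lambda>x. c x # map (\<lambda>g. c (g \<otimes>\<^bsub>G\<^esub> x)) gs) ` carrier G
          = (\<lambda>x. c' x # map (\<lambda>g. c' (g \<otimes>\<^bsub>H\<^esub> x)) hs) ` carrier H"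
    using eq Con_pair_eq_image[OF assms(1) gs cr cE] Con_pair_eq_image[OF assms(2) hsc c'] by simp
  have agree: "length hs = length gs \<and> (f \<circ> c') y = \<chi> x \<and>
      (\<forall>i<length gs. (f \<circ> c') (hs ! i \<otimes>\<^bsub>H\<^esub> y) = \<chi> (gs ! i \<otimes>\<^bsub>G\<^esub> x))"
    if "x \<in> carrier G"
      and e: "c x # map (\<lambda>g. c (g \<otimes>\<^bsub>G\<^esub> x)) gs = c' y # map (\<lambda>g. c' (g \<otimes>\<^bsub>H\<^esub> y)) hs" for x y
  proof -
    have len: "length hs = length gs" using arg_cong[OF e, of length] by simp
    have "c' (hs ! i \<otimes>\<^bsub>H\<^esub> y) = c (gs ! i \<otimes>\<^bsub>G\<^esub> x)" if "i < length gs" for i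
      using arg_cong[OF e, of "\<lambda>l. l ! Suc i"] that len by simp
    moreover have "c' y = c x" using e by simp
    ultimately show ?thesis using len fc gs \<open>x \<in> carrier G\<close> by simp
  qed
  have fwd: "\<exists>y\<in>carrier H.
      c x # map (\<lambda>g. c (g \<otimes>\<^bsub>G\<^esub> x)) gs = c' y # map (\<lambda>g. c' (g \<otimes>\<^bsub>H\<^esub> y)) hs"
    if "x \<in> carrier G" for x
    using imageI[OF that, of "\<lambda>x. c x # map (\<lambda>g. c (g \<otimes>\<^bsub>G\<^esub> x)) gs", unfolded eq] by auto
  show thesis
  \<comment> \<open>Nothing compares \<open>s\<close> with \<open>r\<close> directly, but every
    value of \<open>c'\<close> on \<open>H\<close> is a value of \<open>c\<close>, so
    \<open>f\<close> is applied only inside \<open>{1..r}\<close> and turns indices back into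
    colours.\<close>
  proof (rule that[OF hs, of "f \<circ> c'"])
    show "length hs = length gs" using fwd[OF G.one_closed] agree by blast
  next
    show "\<forall>x\<in>carrier G. \<exists>y\<in>carrier H. (f \<circ> c') y = \<chi> x \<and>
           (\<forall>i<length gs. (f \<circ> c') (hs ! i \<otimes>\<^bsub>H\<^esub> y) = \<chi> (gs ! i \<otimes>\<^bsub>G\<^esub> x))"
    proof
      fix x assume x: "x \<in> carrier G"
      show "\<exists>y\<in>carrier H. (f \<circ> c') y = \<chi> x \<and>
           (\<forall>i<length gs. (f \<circ> c') (hs ! i \<otimes>\<^bsub>H\<^esub> y) = \<chi> (gs ! i \<otimes>\<^bsub>G\<^esub> x))"
        using fwd[OF x] agree[OF x] by blast
    qed
  next
    show "\<forall>y\<in>carrier H. \<exists>x\<in>carrier G. (f \<circ> c') y = \<chi> x \<and>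
           (\<forall>i<length gs. (f \<circ> c') (hs ! i \<otimes>\<^bsub>H\<^esub> y) = \<chi> (gs ! i \<otimes>\<^bsub>G\<^esub> x))"
    proof
      fix y assume y: "y \<in> carrier H"
      then obtain x where "x \<in> carrier G"
        "c x # map (\<lambda>g. c (g \<otimes>\<^bsub>G\<^esub> x)) gs = c' y # map (\<lambda>g. c' (g \<otimes>\<^bsub>H\<^esub> y)) hs"
        using imageI[OF y, of "\<lambda>x. c' x # map (\<lambda>g. c' (g \<otimes>\<^bsub>H\<^esub> x)) hs", folded eq] by auto
      then show "\<exists>x\<in>carrier G. (f \<circ> c') y = \<chi> x \<and>
             (\<forall>i<length gs. (f \<circ> c') (hs ! i \<otimes>\<^bsub>H\<^esub> y) = \<chi> (gs ! i \<otimes>\<^bsub>G\<^esub> x))"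
        using agree by blast
    qed
  qed
qed

text \<open>If the colour of every vertex on a path starting at \<open>\<one>\<close> is attained only once in \<open>G\<close>, the
  path is determined by its colours, so the same word leads to the same colours in \<open>H\<close>.\<close>

lemma colour_of_word:
  assumes "group G" "group H" "set gs \<subseteq> carrier G" "set hs \<subseteq> carrier H" "length hs = length gs"
    and match: "\<forall>y\<in>carrier H. \<exists>x\<in>carrier G. \<chi>' y = \<chi> x \<and>
           (\<forall>i<length gs. \<chi>' (hs ! i \<otimes>\<^bsub>H\<^esub> y) = \<chi> (gs ! i \<otimes>\<^bsub>G\<^esub> x))"
    and w: "w \<in> words (length gs)"
    and single: "\<And>v x. suffix v w \<Longrightarrow> x \<in> carrier G \<Longrightarrow> \<chi> x = \<chi> (word_val G gs v) \<Longrightarrow>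
           x = word_val G gs v"
    and y: "y \<in> carrier H" "\<chi>' y = \<chi> \<one>\<^bsub>G\<^esub>"
  shows "\<chi>' (word_val H hs w \<otimes>\<^bsub>H\<^esub> y) = \<chi> (word_val G gs w)"
proof -
  interpret G: group G by fact
  interpret H: group H by fact
  from w single show ?thesis
  proof (induction w)
    case Nil
    then show ?case using y by simp
  next
    case (Cons l w)
    let ?i = "snd l" and ?x = "word_val G gs w" and ?y = "word_val H hs w \<otimes>\<^bsub>H\<^esub> y"
    have i: "?i < length gs" and w: "w \<in> words (length gs)" using Cons.prems(1) by auto
    have c: "gs ! ?i \<in> carrier G" "hs ! ?i \<in> carrier H"
      using i assms(3-5) by simp_all
    have xc: "?x \<in> carrier G" using w assms(3) by simp
    have yc: "?y \<in> carrier H" "word_val H hs w \<in> carrier H" using w assms(4,5) y by auto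
    have IH: "\<chi>' ?y = \<chi> ?x"
      by (rule Cons.IH[OF w Cons.prems(2)]) (auto intro: suffix_ConsI)
    have sx: "x = ?x" if "x \<in> carrier G" "\<chi> x = \<chi> ?x" for x
      by (rule Cons.prems(2)[OF _ that]) (simp add: suffix_ConsI)
    show ?case
    proof (cases "fst l")
      case True
      obtain x where "x \<in> carrier G" "\<chi>' ?y = \<chi> x" "\<chi>' (hs ! ?i \<otimes>\<^bsub>H\<^esub> ?y) = \<chi> (gs ! ?i \<otimes>\<^bsub>G\<^esub> x)"
        using bspec[OF match yc(1)] i by blast
      moreover from this have "x = ?x" using sx IH by simp
      ultimately show ?thesis using True c yc y by (simp add: H.m_assoc)
    next
      case False
      \<comment> \<open>For an inverse letter the pattern is read at the end of the step:
        \<open>hs ! ?i\<close> takes \<open>?y'\<close> back to \<open>?y\<close>, whose colour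
        identifies the product of \<open>gs ! ?i\<close> and \<open>x\<close> with
        \<open>?x\<close>.\<close>
      let ?y' = "inv\<^bsub>H\<^esub> (hs ! ?i) \<otimes>\<^bsub>H\<^esub> ?y"
      have y'c: "?y' \<in> carrier H" using c yc by blast
      have y': "hs ! ?i \<otimes>\<^bsub>H\<^esub> ?y' = ?y"
        by (rule iffD1[OF H.inv_solve_left[OF y'c c(2) yc(1)] refl, symmetric])
      obtain x where x: "x \<in> carrier G" "\<chi>' ?y' = \<chi> x"
        "\<chi>' (hs ! ?i \<otimes>\<^bsub>H\<^esub> ?y') = \<chi> (gs ! ?i \<otimes>\<^bsub>G\<^esub> x)"
        using bspec[OF match y'c] i by blast
      then have gx: "gs ! ?i \<otimes>\<^bsub>G\<^esub> x = ?x"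
        using sx[of "gs ! ?i \<otimes>\<^bsub>G\<^esub> x"] IH c(1) unfolding y' by (metis G.m_closed)
      have "x = inv\<^bsub>G\<^esub> (gs ! ?i) \<otimes>\<^bsub>G\<^esub> ?x"
        by (rule iffD2[OF G.inv_solve_left[OF x(1) c(1) xc] gx[symmetric]])
      then have "\<chi>' ?y' = \<chi> (inv\<^bsub>G\<^esub> (gs ! ?i) \<otimes>\<^bsub>G\<^esub> ?x)" using x(2) by argo
      moreover have "word_val H hs (l # w) \<otimes>\<^bsub>H\<^esub> y = ?y'"
        using False c yc y by (simp add: H.m_assoc)
      ultimately show ?thesis using False by simp
    qed
  qed
qed

section \<open>Groups with a normal series with cyclic factors\<close>

text \<open>The exponent is kept as an index because signs, remainders and steps by one refer to it.
  Exponents \<open>k\<close> and \<open>l\<close> give the same coset if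
  \<open>g [^] (k - l)\<close> lies in \<open>T\<close>.\<close>

definition power_coset :: "('a, 'b) monoid_scheme \<Rightarrow> 'a \<Rightarrow> 'a set \<Rightarrow> int \<Rightarrow> 'a set" where
  "power_coset G g T k = {g [^]\<^bsub>G\<^esub> k \<otimes>\<^bsub>G\<^esub> t | t. t \<in> T}"

text \<open>The head of the list generates the topmost factor. A factor may be finite, infinite or
  trivial, and a subgroup has to be normal in the whole group before it is extended.\<close>

inductive cyclic_series :: "('a, 'b) monoid_scheme \<Rightarrow> 'a list \<Rightarrow> 'a set \<Rightarrow> bool" for G where
  trivial: "cyclic_series G [] {\<one>\<^bsub>G\<^esub>}"
| extend: "cyclic_series G gs T \<Longrightarrow> T \<lhd> G \<Longrightarrow> g \<in> carrier G \<Longrightarrow>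
    cyclic_series G (g # gs) (\<Union>k. power_coset G g T k)"

context group
begin

section \<open>Cosets of a normal subgroup by the powers of one element\<close>

lemma mult_inv_cancel:
  assumes "x \<in> carrier G" "y \<in> carrier G"
  shows "x \<otimes> (inv x \<otimes> y) = y" and "inv x \<otimes> (x \<otimes> y) = y"
  using assms m_assoc[of x "inv x" y, symmetric] m_assoc[of "inv x" x y, symmetric] by simp_all

lemma power_coset_closed:
  "T \<lhd> G \<Longrightarrow> g \<in> carrier G \<Longrightarrow> x \<in> power_coset G g T k \<Longrightarrow> x \<in> carrier G"
  by (auto simp: power_coset_def dest: normal_imp_subgroup subgroup.mem_carrier)

text \<open>Moving \<open>g [^] l\<close> to the front past \<open>s\<close> conjugates
  \<open>s\<close>, which stays in \<open>T\<close> by normality.\<close>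

lemma power_coset_mult:
  assumes "T \<lhd> G" "g \<in> carrier G" "x \<in> power_coset G g T k" "y \<in> power_coset G g T l"
  shows "x \<otimes> y \<in> power_coset G g T (k + l)"
proof -
  interpret T: normal T G by fact
  obtain s t where st: "s \<in> T" "x = g [^] k \<otimes> s" "t \<in> T" "y = g [^] l \<otimes> t"
    using assms by (auto simp: power_coset_def)
  then have c: "s \<in> carrier G" "t \<in> carrier G" "g [^] k \<in> carrier G" "g [^] l \<in> carrier G"
    using assms(2) by auto
  have "x \<otimes> y = g [^] (k + l) \<otimes> (inv (g [^] l) \<otimes> s \<otimes> g [^] l \<otimes> t)"
    using c st assms(2) by (simp add: int_pow_mult m_assoc mult_inv_cancel)
  moreover have "inv (g [^] l) \<otimes> s \<otimes> g [^] l \<otimes> t \<in> T"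
    using st c T.inv_op_closed1 by blast
  ultimately show ?thesis by (auto simp: power_coset_def)
qed

lemma power_coset_0 [simp]: "T \<lhd> G \<Longrightarrow> power_coset G g T 0 = T"
  using subgroup.mem_carrier[OF normal_imp_subgroup[of T G]] by (force simp: power_coset_def)

lemma int_pow_mem_power_coset: "T \<lhd> G \<Longrightarrow> g \<in> carrier G \<Longrightarrow> g [^] (k :: int) \<in> power_coset G g T k"
  by (auto simp: power_coset_def intro!: exI[of _ \<one>] dest: normal_imp_subgroup subgroup.one_closed)

lemma power_coset_inv:
  assumes "T \<lhd> G" "g \<in> carrier G" "x \<in> power_coset G g T k"
  shows "inv x \<in> power_coset G g T (- k)"
proof -
  interpret T: normal T G by fact
  obtain s where s: "s \<in> T" "x = g [^] k \<otimes> s"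
    using assms by (auto simp: power_coset_def)
  then have "inv x = inv s \<otimes> g [^] (- k)"
    using assms(2) by (simp add: inv_mult_group int_pow_neg)
  moreover have "inv s \<in> power_coset G g T 0" using s assms(1) by simp
  ultimately show ?thesis
    using power_coset_mult[OF assms(1,2) _ int_pow_mem_power_coset[OF assms(1,2)], of "inv s" 0 "- k"]
    by simp
qed

lemma power_coset_int_pow:
  assumes "T \<lhd> G" "g \<in> carrier G" "x \<in> power_coset G g T k"
  shows "x [^] (q :: int) \<in> power_coset G g T (q * k)"
proof -
  have nat: "x [^] n \<in> power_coset G g T (int n * k)" for n :: nat
  proof (induction n)
    case 0
    then show ?case using assms(1) normal_imp_subgroup subgroup.one_closed by fastforce
  next
    case (Suc n)
    then show ?case
      using power_coset_mult[OF assms(1,2) Suc assms(3)] by (simp add: algebra_simps)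
  qed
  have x: "x \<in> carrier G" using power_coset_closed assms by blast
  show ?thesis
  proof (cases "q \<ge> 0")
    case True
    then show ?thesis using nat[of "nat q"] x
      by (metis int_nat_eq int_pow_int)
  next
    case False
    then have "x [^] q = inv (x [^] nat (- q))"
      using x by (metis int_nat_eq int_pow_int int_pow_neg_int linear minus_minus neg_0_le_iff_le)
    then show ?thesis
      using power_coset_inv[OF assms(1,2) nat[of "nat (- q)"]] False by simp
  qed
qed

text \<open>Dividing \<open>x\<close> by itself puts the identity into the coset with exponent
  \<open>k - l\<close>.\<close>

lemma power_coset_disjoint:
  assumes "T \<lhd> G" "g \<in> carrier G" "x \<in> power_coset G g T k" "x \<in> power_coset G g T l"
  shows "g [^] (k - l) \<in> T"
proof -
  interpret T: normal T G by fact
  have x: "x \<in> carrier G" using power_coset_closed assms by blast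
  have "\<one> \<in> power_coset G g T (k - l)"
    using power_coset_mult[OF assms(1-3) power_coset_inv[OF assms(1,2,4)]] x by simp
  then obtain t where t: "t \<in> T" "\<one> = g [^] (k - l) \<otimes> t"
    by (auto simp: power_coset_def)
  then have "g [^] (k - l) = inv t"
    using assms(2) by (metis T.mem_carrier int_pow_closed inv_equality inv_inv)
  then show ?thesis using t by simp
qed

lemma power_coset_eq:
  assumes "T \<lhd> G" "g \<in> carrier G" "g [^] (k - l) \<in> T"
  shows "power_coset G g T k = power_coset G g T l"
proof -
  interpret T: normal T G by fact
  have sub: "power_coset G g T k \<subseteq> power_coset G g T l" if "g [^] (k - l) \<in> T" for k l
  proof
    fix x assume "x \<in> power_coset G g T k"
    then obtain t where t: "t \<in> T" "x = g [^] k \<otimes> t" by (auto simp: power_coset_def)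
    then have "x = g [^] l \<otimes> (g [^] (k - l) \<otimes> t)"
      using assms(2) by (simp add: m_assoc[symmetric] int_pow_mult[symmetric])
    then show "x \<in> power_coset G g T l" using t that by (auto simp: power_coset_def)
  qed
  have "inv (g [^] (k - l)) = g [^] (l - k)"
    using assms(2) int_pow_neg[of g "k - l"] by simp
  then have "g [^] (l - k) \<in> T" using assms(3) T.m_inv_closed by metis
  with sub[OF assms(3)] sub[of l k] show ?thesis by blast
qed

lemma subgroup_power_cosets:
  assumes "T \<lhd> G" "g \<in> carrier G"
  shows "subgroup (\<Union>k. power_coset G g T k) G"
proof (rule subgroupI)
  show "(\<Union>k. power_coset G g T k) \<subseteq> carrier G" using power_coset_closed assms by blast
  show "(\<Union>k. power_coset G g T k) \<noteq> {}" using int_pow_mem_power_coset[OF assms] by blast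
  show "inv a \<in> (\<Union>k. power_coset G g T k)" if "a \<in> (\<Union>k. power_coset G g T k)" for a
    using that power_coset_inv[OF assms] by blast
  show "a \<otimes> b \<in> (\<Union>k. power_coset G g T k)"
    if "a \<in> (\<Union>k. power_coset G g T k)" "b \<in> (\<Union>k. power_coset G g T k)" for a b
    using that power_coset_mult[OF assms] by blast
qed

section \<open>Subgroups of a group with a cyclic series\<close>

lemma cyclic_series_subgroup:
  assumes "cyclic_series G gs S"
  shows "subgroup S G \<and> set gs \<subseteq> S \<and> S \<subseteq> generate G (set gs)"
  using assms
proof induction
  case trivial
  then show ?case using generate.one triv_subgroup by auto
next
  case (extend gs T g)
  let ?U = "\<Union>k. power_coset G g T k"
  have gs: "set gs \<subseteq> carrier G" using extend.IH subgroup.subset by blast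
  have "T \<subseteq> ?U" using power_coset_0[OF extend.hyps(2)] by blast
  moreover have "g \<in> ?U"
    using int_pow_mem_power_coset[OF extend.hyps(2,3), of 1] extend.hyps(3) by auto
  moreover have "x \<in> generate G (set (g # gs))" if xU: "x \<in> ?U" for x
  proof -
    obtain k :: int and t where x: "t \<in> T" "x = g [^] k \<otimes> t"
      using xU unfolding power_coset_def by blast
    have gen: "subgroup (generate G (set (g # gs))) G"
      using generate_is_subgroup gs extend.hyps(3) by simp
    have "t \<in> generate G (set (g # gs))"
      using x extend.IH mono_generate[of "set gs" "set (g # gs)"] by auto
    moreover have "g [^] k \<in> generate G (set (g # gs))"
      using generate_pow[of g] extend.hyps(3) mono_generate[of "{g}" "set (g # gs)"] by auto
    ultimately show ?thesis using x gen by (simp add: subgroup.m_closed)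
  qed
  ultimately show ?case using subgroup_power_cosets[OF extend.hyps(2,3)] extend.IH by auto
qed

text \<open>Induction along the series: to generators of \<open>K \<inter> T\<close> one adds an
  element of \<open>K\<close> whose exponent of \<open>g\<close> is positive and least possible.
  Division with remainder then brings every element of \<open>K\<close> into
  \<open>K \<inter> T\<close>.\<close>

lemma subgroup_finite_generating_set:
  assumes "cyclic_series G gs S" "subgroup K G" "K \<subseteq> S"
  obtains Y where "finite Y" "Y \<subseteq> K" "K = generate G Y"
proof -
  have "\<exists>Y. finite Y \<and> Y \<subseteq> K \<and> K = generate G Y"
    using assms
  proof (induction arbitrary: K)
    case trivial
    then have "K = {\<one>}" using subgroup.one_closed by blast
    then show ?case using generate_one by (intro exI[of _ "{}"]) (auto simp: generate_empty)
  next
    case (extend gs T g)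
    note Tg = extend.hyps(2,3)
    interpret T: normal T G by fact
    interpret K: subgroup K G by fact
    obtain Y where Y: "finite Y" "Y \<subseteq> K \<inter> T" "K \<inter> T = generate G Y"
      using extend.IH[of "K \<inter> T"] subgroups_Inter_pair[OF extend.prems(1) T.subgroup_axioms] by blast
    define P where "P n \<longleftrightarrow> n > 0 \<and> K \<inter> power_coset G g T (int n) \<noteq> {}" for n
    \<comment> \<open>Passing to the inverse turns a negative exponent into a positive one.\<close>
    have neg: "P (nat \<bar>k\<bar>)" if "x \<in> K" "x \<in> power_coset G g T k" "k \<noteq> 0" for x k
    proof (cases "k > 0")
      case True
      then have "x \<in> power_coset G g T (int (nat \<bar>k\<bar>))" using that(2) by simp
      with that show ?thesis unfolding P_def by (metis IntI empty_iff zero_less_abs_iff zero_less_nat_eq)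
    next
      case False
      then have "inv x \<in> power_coset G g T (int (nat \<bar>k\<bar>))"
        using power_coset_inv[OF Tg that(2)] by simp
      with that(3) K.m_inv_closed[OF that(1)] show ?thesis
        unfolding P_def by (metis IntI empty_iff zero_less_abs_iff zero_less_nat_eq)
    qed
    show ?case
    proof (cases "\<exists>n. P n")
      case False
      \<comment> \<open>Without positive exponents, every element of \<open>K\<close> has exponent
        zero, so \<open>K\<close> lies in \<open>T\<close> and no new generator arises.\<close>
      have "x \<in> T" if xK: "x \<in> K" for x
      proof -
        obtain k where k: "x \<in> power_coset G g T k" using xK extend.prems(2) by blast
        then have "k = 0" using neg[OF xK k] False by blast
        with k show ?thesis using power_coset_0[OF Tg(1)] by simp
      qed
      then have "K \<inter> T = K" by blast
      then show ?thesis using Y by auto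
    next
      case True
      define d where "d = (LEAST n. P n)"
      have d: "P d" "\<And>n. P n \<Longrightarrow> d \<le> n"
        unfolding d_def using True by (auto intro: LeastI Least_le)
      then obtain y where y: "y \<in> K" "y \<in> power_coset G g T (int d)" unfolding P_def by blast
      have "x \<in> generate G (insert y Y)" if xK: "x \<in> K" for x
      proof -
        obtain k where k: "x \<in> power_coset G g T k" using xK extend.prems(2) by blast
        define q where "q = k div int d"
        \<comment> \<open>Removing the \<open>q\<close>-th power of \<open>y\<close> leaves the
          remainder of the exponent modulo \<open>d\<close>. Minimality of \<open>d\<close> makes it
          zero, so \<open>?z\<close> lies in \<open>T\<close>.\<close>
        let ?z = "y [^] (- q) \<otimes> x"
        have "y [^] (- q) \<in> K" using y(1) K.subgroup_axioms subgroup_int_pow_closed by blast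
        then have zK: "?z \<in> K" using that by simp
        have "?z \<in> power_coset G g T (- q * int d + k)"
          using power_coset_mult[OF Tg power_coset_int_pow[OF Tg y(2), of "- q"] k] .
        also have "- q * int d + k = k mod int d"
          unfolding q_def using minus_div_mult_eq_mod[of k "int d"] by simp
        finally have z: "?z \<in> power_coset G g T (k mod int d)" .
        have "k mod int d = 0"
        proof (rule ccontr)
          assume "k mod int d \<noteq> 0"
          then have "d \<le> nat \<bar>k mod int d\<bar>" by (intro d(2) neg[OF zK z])
          moreover have "0 < int d" using d(1) by (simp add: P_def)
          moreover from this have "0 \<le> k mod int d" "k mod int d < int d" by simp_all
          ultimately show False by linarith
        qed
        with z have "?z \<in> T" using power_coset_0[OF Tg(1)] by simp
        with zK have "?z \<in> generate G Y" unfolding Y(3)[symmetric] by (rule IntI)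
        then have zg: "?z \<in> generate G (insert y Y)" using mono_generate[of Y "insert y Y"] by blast
        have gen: "subgroup (generate G (insert y Y)) G"
          by (rule generate_is_subgroup) (use y(1) Y(2) K.subset in blast)
        have "y [^] q \<in> generate G (insert y Y)"
          using subgroup_int_pow_closed[OF gen] generate.incl[of y "insert y Y" G] by blast
        then have "y [^] q \<otimes> ?z \<in> generate G (insert y Y)"
          using zg by (rule subgroup.m_closed[OF gen])
        moreover have "y [^] q \<otimes> ?z = x"
          using y(1) xK by (simp add: int_pow_neg mult_inv_cancel)
        ultimately show ?thesis by simp
      qed
      moreover have "generate G (insert y Y) \<subseteq> K"
        by (rule generate_subgroup_incl[OF _ extend.prems(1)]) (use y(1) Y(2) in blast)
      ultimately show ?thesis using y(1) Y(1,2) by (intro exI[of _ "insert y Y"]) blast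
    qed
  qed
  then show thesis using that by blast
qed

text \<open>Since every subgroup is finitely generated, the kernels of the iterates of an endomorphism
  form an ascending chain that becomes stationary.\<close>

lemma surjective_endomorphism_inj:
  assumes "cyclic_series G gs (carrier G)" "\<phi> \<in> hom G G" "\<phi> ` carrier G = carrier G"
  shows "inj_on \<phi> (carrier G)"
proof -
  interpret \<phi>: group_hom G G \<phi> using assms(2) by unfold_locales
  have hom: "(\<phi> ^^ n) \<in> hom G G" for n
  proof (induction n)
    case 0
    show ?case by (simp add: hom_def)
  next
    case (Suc n)
    show ?case unfolding funpow.simps by (rule Group.hom_compose[OF Suc assms(2)])
  qed
  have surj: "(\<phi> ^^ n) ` carrier G = carrier G" for n
  proof (induction n)
    case (Suc n)
    show ?case unfolding funpow.simps image_comp[symmetric] Suc by (rule assms(3))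
  qed simp
  define K where "K n = kernel G G (\<phi> ^^ n)" for n
  have sub: "subgroup (K n) G" for n
  proof -
    interpret group_hom G G "\<phi> ^^ n" using hom by unfold_locales
    show ?thesis unfolding K_def by (rule subgroup_kernel)
  qed
  have "K n \<subseteq> K (Suc n)" for n by (auto simp: K_def kernel_def)
  then have mono: "K m \<subseteq> K n" if "m \<le> n" for m n
    using that by (rule lift_Suc_mono_le)
  have U: "subgroup (\<Union>n. K n) G"
  proof (rule subgroupI)
    show "(\<Union>n. K n) \<subseteq> carrier G" using subgroup.subset[OF sub] by blast
    show "(\<Union>n. K n) \<noteq> {}" using subgroup.one_closed[OF sub] by blast
    show "inv a \<in> (\<Union>n. K n)" if "a \<in> (\<Union>n. K n)" for a
      using that subgroup.m_inv_closed[OF sub] by blast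
    show "a \<otimes> b \<in> (\<Union>n. K n)" if ab: "a \<in> (\<Union>n. K n)" "b \<in> (\<Union>n. K n)" for a b
    proof -
      obtain m n where "a \<in> K m" "b \<in> K n" using ab by blast
      then have "a \<in> K (max m n)" "b \<in> K (max m n)" using mono[of m "max m n"] mono[of n "max m n"] by auto
      then have "a \<otimes> b \<in> K (max m n)" by (rule subgroup.m_closed[OF sub])
      then show ?thesis by blast
    qed
  qed
  obtain Y where Y: "finite Y" "Y \<subseteq> (\<Union>n. K n)" "(\<Union>n. K n) = generate G Y"
    by (rule subgroup_finite_generating_set[OF assms(1) U subgroup.subset[OF U]])
  have "\<exists>n. Y \<subseteq> K n"
    using Y(1,2)
  proof (induction Y rule: finite_induct)
    case (insert y Y)
    then obtain m n where "Y \<subseteq> K m" "y \<in> K n" by auto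
    then have "insert y Y \<subseteq> K (max m n)" using mono[of m "max m n"] mono[of n "max m n"] by auto
    then show ?case by blast
  qed simp
  \<comment> \<open>The finitely many generators of the union lie in a single kernel, where the
    chain stops.\<close>
  then obtain n where "Y \<subseteq> K n" by blast
  then have "generate G Y \<subseteq> K n" by (rule generate_subgroup_incl[OF _ sub])
  then have stat: "K (Suc n) \<subseteq> K n" unfolding Y(3)[symmetric] by blast
  have "x = \<one>" if x: "x \<in> carrier G" "\<phi> x = \<one>" for x
  proof -
    \<comment> \<open>Surjectivity of the \<open>n\<close>-th iterate pulls \<open>x\<close> back to
      \<open>z\<close>. One more application of \<phi> kills \<open>z\<close>, so the
      \<open>n\<close>-th iterate kills it already, and its image \<open>x\<close> is
      trivial.\<close>
    obtain z where z: "z \<in> carrier G" "x = (\<phi> ^^ n) z" using surj[of n] x(1) by blast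
    then have "z \<in> K (Suc n)" using x by (simp add: K_def kernel_def)
    then have "z \<in> K n" using stat by blast
    then show ?thesis using z by (simp add: K_def kernel_def)
  qed
  then have "kernel G G \<phi> \<subseteq> {\<one>}" unfolding kernel_def by blast
  moreover have "\<one> \<in> kernel G G \<phi>" by (simp add: kernel_def)
  ultimately have "kernel G G \<phi> = {\<one>}" by blast
  then show ?thesis by (rule \<phi>.trivial_ker_imp_inj)
qed

end

section \<open>Groups of class at most 2\<close>

definition center_set :: "('a, 'b) monoid_scheme \<Rightarrow> 'a set" where
  "center_set G = {c \<in> carrier G. \<forall>z\<in>carrier G. c \<otimes>\<^bsub>G\<^esub> z = z \<otimes>\<^bsub>G\<^esub> c}"

definition commutators_central :: "('a, 'b) monoid_scheme \<Rightarrow> bool" where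
  "commutators_central G \<longleftrightarrow> (\<forall>x\<in>carrier G. \<forall>y\<in>carrier G.
     x \<otimes>\<^bsub>G\<^esub> y \<otimes>\<^bsub>G\<^esub> inv\<^bsub>G\<^esub> x \<otimes>\<^bsub>G\<^esub> inv\<^bsub>G\<^esub> y \<in> center_set G)"

context group
begin

lemma center_set_commute: "c \<in> center_set G \<Longrightarrow> z \<in> carrier G \<Longrightarrow> c \<otimes> z = z \<otimes> c"
  by (simp add: center_set_def)

lemma center_set_closed: "c \<in> center_set G \<Longrightarrow> c \<in> carrier G"
  by (simp add: center_set_def)

lemma subgroup_center_set: "subgroup (center_set G) G"
proof (rule subgroupI)
  show "center_set G \<subseteq> carrier G" by (auto simp: center_set_def)
  have "\<one> \<in> center_set G" by (simp add: center_set_def)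
  then show "center_set G \<noteq> {}" by blast
  show "inv a \<in> center_set G" if a: "a \<in> center_set G" for a
  proof -
    have ac: "a \<in> carrier G" using a by (rule center_set_closed)
    have "inv a \<otimes> z = z \<otimes> inv a" if z: "z \<in> carrier G" for z
    proof -
      have "inv a \<otimes> z = inv a \<otimes> (z \<otimes> a \<otimes> inv a)" using ac z by (simp add: m_assoc)
      also have "z \<otimes> a = a \<otimes> z" using center_set_commute[OF a z] ..
      also have "inv a \<otimes> (a \<otimes> z \<otimes> inv a) = z \<otimes> inv a"
        using ac z by (simp add: m_assoc mult_inv_cancel)
      finally show ?thesis .
    qed
    with ac show ?thesis by (simp add: center_set_def)
  qed
  show "a \<otimes> b \<in> center_set G" if a: "a \<in> center_set G" and b: "b \<in> center_set G" for a b
  proof -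
    have c: "a \<in> carrier G" "b \<in> carrier G" using a b by (simp_all add: center_set_closed)
    have "a \<otimes> b \<otimes> z = z \<otimes> (a \<otimes> b)" if z: "z \<in> carrier G" for z
    proof -
      have "a \<otimes> b \<otimes> z = a \<otimes> (b \<otimes> z)" using c z by (rule m_assoc)
      also have "b \<otimes> z = z \<otimes> b" using b z by (rule center_set_commute)
      also have "a \<otimes> (z \<otimes> b) = a \<otimes> z \<otimes> b" using c z by (simp add: m_assoc)
      also have "a \<otimes> z = z \<otimes> a" using a z by (rule center_set_commute)
      finally show ?thesis using c z by (simp add: m_assoc)
    qed
    with c show ?thesis by (simp add: center_set_def)
  qed
qed

text \<open>The equation says that the commutator of \<open>a\<close> and \<open>b\<close> is
  \<open>s\<close>. Central factors can be collected at the front, so a product of elements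
  \<open>a\<close> multiplies the factors and an inverse inverts them.\<close>

lemma subgroup_commuting_modulo:
  assumes "subgroup S G" "S \<subseteq> center_set G" "b \<in> carrier G"
  shows "subgroup {a \<in> carrier G. \<exists>s\<in>S. a \<otimes> b = s \<otimes> (b \<otimes> a)} G" (is "subgroup ?C G")
proof (rule subgroupI)
  show "?C \<subseteq> carrier G" by blast
  have "\<one> \<in> ?C"
    using assms(3) subgroup.one_closed[OF assms(1)] by (auto intro!: bexI[of _ \<one>])
  then show "?C \<noteq> {}" by blast
  show "inv a \<in> ?C" if aC: "a \<in> ?C" for a
  proof -
    obtain s where s: "s \<in> S" and eq: "a \<otimes> b = s \<otimes> (b \<otimes> a)" and a: "a \<in> carrier G" using aC by blast
    have sc: "s \<in> carrier G" using assms(1) s by (rule subgroup.mem_carrier)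
    have sZ: "s \<in> center_set G" using s assms(2) by blast
    have "inv s \<otimes> (b \<otimes> inv a) = inv s \<otimes> (inv a \<otimes> (a \<otimes> b) \<otimes> inv a)"
      using a assms(3) by (simp add: mult_inv_cancel)
    also have "\<dots> = inv s \<otimes> (inv a \<otimes> s \<otimes> b)"
      unfolding eq using a sc assms(3) by (simp add: m_assoc)
    also have "inv a \<otimes> s = s \<otimes> inv a" using center_set_commute[OF sZ, of "inv a"] a by simp
    also have "inv s \<otimes> (s \<otimes> inv a \<otimes> b) = inv a \<otimes> b"
      using a sc assms(3) by (simp add: m_assoc mult_inv_cancel)
    finally have "inv a \<otimes> b = inv s \<otimes> (b \<otimes> inv a)" ..
    with a subgroup.m_inv_closed[OF assms(1) s] show ?thesis by blast
  qed
  show "a \<otimes> c \<in> ?C" if acC: "a \<in> ?C" "c \<in> ?C" for a c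
  proof -
    obtain s t where s: "s \<in> S" and eq: "a \<otimes> b = s \<otimes> (b \<otimes> a)" and a: "a \<in> carrier G"
      and t: "t \<in> S" and eq': "c \<otimes> b = t \<otimes> (b \<otimes> c)" and c: "c \<in> carrier G" using acC by blast
    have sc: "s \<in> carrier G" "t \<in> carrier G"
      using s t by (simp_all add: subgroup.mem_carrier[OF assms(1)])
    have tZ: "t \<in> center_set G" using t assms(2) by blast
    have "a \<otimes> c \<otimes> b = a \<otimes> t \<otimes> b \<otimes> c"
      using a c assms(3) sc by (simp add: m_assoc eq')
    also have "a \<otimes> t = t \<otimes> a" using center_set_commute[OF tZ a] ..
    also have "t \<otimes> a \<otimes> b \<otimes> c = t \<otimes> (a \<otimes> b) \<otimes> c" using a c assms(3) sc by (simp add: m_assoc)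
    also have "\<dots> = t \<otimes> s \<otimes> (b \<otimes> (a \<otimes> c))"
      unfolding eq using a c assms(3) sc by (simp add: m_assoc)
    finally show ?thesis using a c subgroup.m_closed[OF assms(1) t s] by blast
  qed
qed

text \<open>\<open>subgroup_commuting_modulo\<close> extends the relation from \<open>Y\<close> to
  \<open>generate G Y\<close> in one argument at a time, first against a fixed generator, then
  against a fixed arbitrary element. Exchanging the arguments in between replaces \<open>s\<close>
  by its inverse.\<close>

lemma generate_commuting_modulo:
  assumes "subgroup S G" "S \<subseteq> center_set G" "Y \<subseteq> carrier G"
    and Y: "\<And>x y. x \<in> Y \<Longrightarrow> y \<in> Y \<Longrightarrow> x \<otimes> y \<otimes> inv x \<otimes> inv y \<in> S"
    and ab: "a \<in> generate G Y" "b \<in> generate G Y"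
  shows "\<exists>s\<in>S. a \<otimes> b = s \<otimes> (b \<otimes> a)"
proof -
  let ?C = "\<lambda>b. {a \<in> carrier G. \<exists>s\<in>S. a \<otimes> b = s \<otimes> (b \<otimes> a)}"
  have comm: "x \<otimes> y = x \<otimes> y \<otimes> inv x \<otimes> inv y \<otimes> (y \<otimes> x)" if "x \<in> Y" "y \<in> Y" for x y
  proof -
    have "x \<in> carrier G" "y \<in> carrier G" using that assms(3) by blast+
    then show ?thesis by (simp add: m_assoc mult_inv_cancel)
  qed
  have 1: "a \<in> ?C x" if x: "x \<in> Y" and a: "a \<in> generate G Y" for x a
  proof -
    have xc: "x \<in> carrier G" using x assms(3) by blast
    have "Y \<subseteq> ?C x" using comm Y x assms(3) by blast
    then have "generate G Y \<subseteq> ?C x"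
      by (rule generate_subgroup_incl[OF _ subgroup_commuting_modulo[OF assms(1,2) xc]])
    with a show ?thesis by blast
  qed
  have ac: "a \<in> carrier G" using ab(1) generate_in_carrier[OF assms(3)] by blast
  have "x \<in> ?C a" if x: "x \<in> Y" for x
  proof -
    have xc: "x \<in> carrier G" using x assms(3) by blast
    obtain s where s: "s \<in> S" "a \<otimes> x = s \<otimes> (x \<otimes> a)" using 1[OF x ab(1)] by blast
    have sc: "s \<in> carrier G" using assms(1) s(1) by (rule subgroup.mem_carrier)
    have "x \<otimes> a = inv s \<otimes> (a \<otimes> x)" unfolding s(2) using sc xc ac by (simp add: mult_inv_cancel)
    with xc subgroup.m_inv_closed[OF assms(1) s(1)] show ?thesis by blast
  qed
  then have "Y \<subseteq> ?C a" by blast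
  then have "generate G Y \<subseteq> ?C a"
    by (rule generate_subgroup_incl[OF _ subgroup_commuting_modulo[OF assms(1,2) ac]])
  with ab(2) obtain s where s: "s \<in> S" "b \<otimes> a = s \<otimes> (a \<otimes> b)" by blast
  have bc: "b \<in> carrier G" using ab(2) generate_in_carrier[OF assms(3)] by blast
  have sc: "s \<in> carrier G" using assms(1) s(1) by (rule subgroup.mem_carrier)
  have "a \<otimes> b = inv s \<otimes> (b \<otimes> a)" unfolding s(2) using sc bc ac by (simp add: mult_inv_cancel)
  with subgroup.m_inv_closed[OF assms(1) s(1)] show ?thesis by blast
qed

text \<open>Conjugation changes an element of \<open>T\<close> only by a factor in \<open>S\<close>,
  which lies in \<open>T\<close>.\<close>

lemma normal_if_commuting_modulo:
  assumes "subgroup T G" "S \<subseteq> T"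
    and "\<And>a b. a \<in> carrier G \<Longrightarrow> b \<in> T \<Longrightarrow> \<exists>s\<in>S. a \<otimes> b = s \<otimes> (b \<otimes> a)"
  shows "T \<lhd> G"
  unfolding normal_inv_iff
proof (intro conjI ballI)
  fix x h assume x: "x \<in> carrier G" and h: "h \<in> T"
  obtain s where s: "s \<in> S" "x \<otimes> h = s \<otimes> (h \<otimes> x)" using assms(3)[OF x h] by blast
  have sT: "s \<in> T" using s assms(2) by blast
  have c: "s \<in> carrier G" "h \<in> carrier G" using sT h by (simp_all add: subgroup.mem_carrier[OF assms(1)])
  have "x \<otimes> h \<otimes> inv x = s \<otimes> h" unfolding s(2) using c x by (simp add: m_assoc)
  with subgroup.m_closed[OF assms(1) sT h] show "x \<otimes> h \<otimes> inv x \<in> T" by simp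
qed (rule assms(1))

text \<open>Every subgroup inside the centre is normal, so central elements can be adjoined one
  after another.\<close>

lemma cyclic_series_central:
  assumes "set cs \<subseteq> center_set G"
  shows "\<exists>S. cyclic_series G cs S \<and> S \<subseteq> center_set G \<and> S \<lhd> G"
  using assms
proof (induction cs)
  case Nil
  have "{\<one>} \<subseteq> center_set G" using subgroup.one_closed[OF subgroup_center_set] by blast
  then show ?case using cyclic_series.trivial one_is_normal by blast
next
  case (Cons c cs)
  then obtain S where S: "cyclic_series G cs S" "S \<subseteq> center_set G" "S \<lhd> G" by auto
  let ?U = "\<Union>k. power_coset G c S k"
  have c: "c \<in> center_set G" using Cons.prems by simp
  then have cc: "c \<in> carrier G" by (rule center_set_closed)
  have ser: "cyclic_series G (c # cs) ?U" using S(1,3) cc by (rule cyclic_series.extend)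
  have "x \<in> center_set G" if xU: "x \<in> ?U" for x
  proof -
    obtain k s where "s \<in> S" "x = c [^] (k :: int) \<otimes> s" using xU by (auto simp: power_coset_def)
    then show ?thesis
      using subgroup.m_closed[OF subgroup_center_set]
        subgroup_int_pow_closed[OF subgroup_center_set c] S(2) by auto
  qed
  then have U: "?U \<subseteq> center_set G" by blast
  have "?U \<lhd> G"
  proof (rule normal_if_commuting_modulo[where S = "{\<one>}"])
    show sub: "subgroup ?U G" using S(3) cc by (rule subgroup_power_cosets)
    show "{\<one>} \<subseteq> ?U" using subgroup.one_closed[OF sub] by blast
    show "\<exists>s\<in>{\<one>}. a \<otimes> b = s \<otimes> (b \<otimes> a)" if "a \<in> carrier G" "b \<in> ?U" for a b
    proof -
      have "b \<in> center_set G" using U that(2) by blast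
      then show ?thesis using center_set_commute[of b a] center_set_closed[of b] that(1) by simp
    qed
  qed
  with ser U show ?case by blast
qed

text \<open>The bottom of the series is built from the commutators of the generators. They are
  central, and modulo the subgroup \<open>S\<close> that they generate all elements commute. Hence
  every subgroup above \<open>S\<close> is normal, and the generators themselves can be adjoined
  next.\<close>

lemma cyclic_series_class2:
  assumes "commutators_central G" "set xs \<subseteq> carrier G" "generate G (set xs) = carrier G"
  obtains gs where "cyclic_series G gs (carrier G)"
proof -
  define cs where "cs = map (\<lambda>(x, y). x \<otimes> y \<otimes> inv x \<otimes> inv y) (List.product xs xs)"
  have cs: "x \<otimes> y \<otimes> inv x \<otimes> inv y \<in> set cs" if "x \<in> set xs" "y \<in> set xs" for x y
    using that by (force simp: cs_def)
  have "set cs \<subseteq> center_set G"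
    using assms(1,2) unfolding cs_def commutators_central_def by auto
  then obtain S where S: "cyclic_series G cs S" "S \<subseteq> center_set G" "S \<lhd> G"
    using cyclic_series_central by blast
  have Ssub: "subgroup S G" and csS: "set cs \<subseteq> S" using cyclic_series_subgroup[OF S(1)] by blast+
  have comm: "\<exists>s\<in>S. a \<otimes> b = s \<otimes> (b \<otimes> a)" if "a \<in> carrier G" "b \<in> carrier G" for a b
    by (rule generate_commuting_modulo[OF Ssub S(2) assms(2)])
      (use cs csS that assms(3) in blast)+
  have "\<exists>T. cyclic_series G (ys @ cs) T \<and> S \<subseteq> T \<and> T \<lhd> G" if "set ys \<subseteq> carrier G" for ys
    using that
  proof (induction ys)
    case Nil
    then show ?case using S by auto
  next
    case (Cons y ys)
    then obtain T where T: "cyclic_series G (ys @ cs) T" "S \<subseteq> T" "T \<lhd> G" by auto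
    have y: "y \<in> carrier G" using Cons.prems by simp
    let ?U = "\<Union>k. power_coset G y T k"
    have ser: "cyclic_series G ((y # ys) @ cs) ?U"
      using cyclic_series.extend[OF T(1,3) y] by simp
    have sub: "subgroup ?U G" using T(3) y by (rule subgroup_power_cosets)
    have SU: "S \<subseteq> ?U" using T(2) power_coset_0[OF T(3), of y] by blast
    have "?U \<lhd> G"
      using sub SU by (rule normal_if_commuting_modulo)
        (use comm subgroup.mem_carrier[OF sub] in blast)
    with ser SU show ?case by blast
  qed
  then obtain T where T: "cyclic_series G (xs @ cs) T" using assms(2) by blast
  have "subgroup T G" "set xs \<subseteq> T" using cyclic_series_subgroup[OF T] by auto
  then have "generate G (set xs) \<subseteq> T" "T \<subseteq> carrier G"
    using generate_subgroup_incl subgroup.subset by blast+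
  with T assms(3) have "cyclic_series G (xs @ cs) (carrier G)" by simp
  then show thesis by (rule that)
qed

end

section \<open>Partitions with forced paths\<close>

text \<open>Elements reachable from the identity by multiplications with generators such that the block
  (of the partition \<open>P\<close>) before the step determines the block after it.\<close>

inductive_set forced :: "('a, 'b) monoid_scheme \<Rightarrow> 'a list \<Rightarrow> 'a set set \<Rightarrow> 'a set"
  for G gs P where
  one: "\<one>\<^bsub>G\<^esub> \<in> forced G gs P"
| mult: "x \<in> forced G gs P \<Longrightarrow> g \<in> set gs \<Longrightarrow> A \<in> P \<Longrightarrow> x \<in> A \<Longrightarrow> B \<in> P \<Longrightarrow>
    \<forall>a\<in>A. g \<otimes>\<^bsub>G\<^esub> a \<in> B \<Longrightarrow> g \<otimes>\<^bsub>G\<^esub> x \<in> forced G gs P"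
| inv_mult: "x \<in> forced G gs P \<Longrightarrow> g \<in> set gs \<Longrightarrow> A \<in> P \<Longrightarrow> x \<in> A \<Longrightarrow> B \<in> P \<Longrightarrow>
    \<forall>a\<in>A. inv\<^bsub>G\<^esub> g \<otimes>\<^bsub>G\<^esub> a \<in> B \<Longrightarrow> inv\<^bsub>G\<^esub> g \<otimes>\<^bsub>G\<^esub> x \<in> forced G gs P"

text \<open>When the series grows, the blocks inside \<open>T\<close> are kept, so the paths inside
  \<open>T\<close> remain forced.\<close>

lemma forced_mono:
  assumes "set gs \<subseteq> set hs" "P \<subseteq> Q" "x \<in> forced G gs P"
  shows "x \<in> forced G hs Q"
  using assms(3)
proof induction
  case one
  show ?case by (rule forced.one)
next
  case (mult x g A B)
  show ?case by (rule forced.mult[of x G hs Q g A B]) (use mult assms(1,2) in auto)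
next
  case (inv_mult x g A B)
  show ?case by (rule forced.inv_mult[of x G hs Q g A B]) (use inv_mult assms(1,2) in auto)
qed

context group
begin

section \<open>Extending a forced partition by one cyclic factor\<close>

lemma power_coset_mod:
  assumes "T \<lhd> G" "g \<in> carrier G" "g [^] (e :: int) \<in> T"
  shows "power_coset G g T k = power_coset G g T (k mod e)"
proof (rule power_coset_eq[OF assms(1,2)])
  have "k - k mod e = e * (k div e)" by (simp add: minus_mod_eq_mult_div)
  then have "g [^] (k - k mod e) = (g [^] e) [^] (k div e)"
    using assms(2) by (simp add: int_pow_pow)
  then show "g [^] (k - k mod e) \<in> T"
    using subgroup_int_pow_closed[OF normal_imp_subgroup[OF assms(1)] assms(3)] by simp
qed

lemma power_coset_step:
  assumes "T \<lhd> G" "g \<in> carrier G" "x \<in> power_coset G g T k"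
  shows "g \<otimes> x \<in> power_coset G g T (k + 1)" "inv g \<otimes> x \<in> power_coset G g T (k - 1)"
proof -
  have g: "g \<in> power_coset G g T 1"
    using int_pow_mem_power_coset[OF assms(1,2), of 1] assms(2) by simp
  show "g \<otimes> x \<in> power_coset G g T (k + 1)"
    using power_coset_mult[OF assms(1,2) g assms(3)] by (simp add: add.commute)
  show "inv g \<otimes> x \<in> power_coset G g T (k - 1)"
    using power_coset_mult[OF assms(1,2) power_coset_inv[OF assms(1,2) g] assms(3)] by simp
qed

text \<open>The new blocks are the cosets of \<open>T\<close> other than \<open>T\<close>.
  Multiplication by \<open>g\<close> carries each coset into the next one, so everything is reached
  coset by coset, starting from \<open>T\<close>.\<close>

lemma forced_partition_finite_index:
  assumes T: "T \<lhd> G" and g: "g \<in> carrier G" and e: "e > 0" "g [^] (e :: int) \<in> T"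
    and P: "finite P" "disjoint P" "\<Union>P = T" "{\<one>} \<in> P" "T \<subseteq> forced G gs P"
  obtains Q where "finite Q" "disjoint Q" "\<Union>Q = (\<Union>k. power_coset G g T k)" "{\<one>} \<in> Q"
    "(\<Union>k. power_coset G g T k) \<subseteq> forced G (g # gs) Q"
proof -
  let ?c = "power_coset G g T"
  define Q where "Q = P \<union> (range ?c - {T})"
  have mod: "?c k = ?c (k mod e)" for k using T g e(2) by (rule power_coset_mod)
  have "?c k \<in> ?c ` {0..<e}" for k
    by (rule image_eqI[where x = "k mod e"], rule mod) (use e(1) in simp)
  then have "range ?c \<subseteq> ?c ` {0..<e}" by blast
  then have fin: "finite Q" using P(1) finite_subset[of "range ?c" "?c ` {0..<e}"] by (simp add: Q_def)
  have dis: "?c k = ?c l" if "x \<in> ?c k" "x \<in> ?c l" for k l x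
    by (rule power_coset_eq[OF T g power_coset_disjoint[OF T g that]])
  have disT: "A \<inter> ?c k = {}" if "A \<in> P" "?c k \<noteq> T" for A k
  proof (rule ccontr)
    assume "A \<inter> ?c k \<noteq> {}"
    then obtain x where x: "x \<in> A" "x \<in> ?c k" by blast
    then have "x \<in> ?c 0" using that(1) P(3) T by auto
    then have "?c 0 = ?c k" using x(2) by (rule dis)
    with that(2) T show False by simp
  qed
  have disj: "disjoint Q"
    unfolding Q_def
  proof (rule disjoint_union)
    show "disjoint (range ?c - {T})"
    proof (rule disjointI)
      fix A B assume "A \<in> range ?c - {T}" "B \<in> range ?c - {T}" and ne: "A \<noteq> B"
      then obtain k l where "A = ?c k" "B = ?c l" by blast
      with ne show "A \<inter> B = {}" by (auto dest: dis)
    qed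
    show "\<Union>P \<inter> \<Union>(range ?c - {T}) = {}" using disT by blast
  qed (rule P(2))
  have un: "\<Union>Q = (\<Union>k. ?c k)"
    using P(3) power_coset_0[OF T, of g] by (auto simp: Q_def)
  have TQ: "T \<subseteq> forced G (g # gs) Q"
  proof
    fix x assume "x \<in> T"
    then have "x \<in> forced G gs P" using P(5) by blast
    then show "x \<in> forced G (g # gs) Q" by (rule forced_mono[rotated 2]) (auto simp: Q_def)
  qed
  \<comment> \<open>\<open>Q\<close> refines the cosets: blocks inside \<open>T\<close> come from
    \<open>P\<close>, and every other coset is a block. So a block determines the coset into which
    \<open>g\<close> leads.\<close>
  have block: "\<exists>A\<in>Q. y \<in> A \<and> A \<subseteq> ?c k" if "y \<in> ?c k" for y k
  proof (cases "?c k = T")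
    case True
    with that obtain A where "A \<in> P" "y \<in> A" using P(3) by auto
    moreover have "A \<subseteq> T" using \<open>A \<in> P\<close> P(3) by blast
    ultimately show ?thesis unfolding True Q_def by blast
  next
    case False
    then have "?c k \<in> Q" unfolding Q_def by blast
    with that show ?thesis by blast
  qed
  have nat: "?c (int n) \<subseteq> forced G (g # gs) Q" for n
  proof (induction n)
    case 0
    then show ?case using TQ power_coset_0[OF T] by simp
  next
    case (Suc n)
    show ?case
    proof
      fix x assume x: "x \<in> ?c (int (Suc n))"
      show "x \<in> forced G (g # gs) Q"
      proof (cases "?c (int (Suc n)) = T")
        \<comment> \<open>When the cosets have come round to \<open>T\<close>, which need not be a
          block, \<open>x\<close> is reached by a path inside \<open>T\<close>.\<close>
        case True
        then show ?thesis using x TQ by blast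
      next
        case False
        let ?y = "inv g \<otimes> x"
        have xc: "x \<in> carrier G" using power_coset_closed[OF T g x] .
        have y: "?y \<in> ?c (int n)" using power_coset_step(2)[OF T g x] by simp
        then obtain A where A: "A \<in> Q" "?y \<in> A" "A \<subseteq> ?c (int n)" using block by blast
        have "g \<otimes> a \<in> ?c (int (Suc n))" if "a \<in> A" for a
        proof -
          have "a \<in> ?c (int n)" using that A(3) by blast
          then show ?thesis
            using power_coset_step(1)[OF T g, of a "int n"] by (simp add: add.commute)
        qed
        moreover have "?c (int (Suc n)) \<in> Q" using False unfolding Q_def by blast
        moreover have "?y \<in> forced G (g # gs) Q" using y Suc by blast
        ultimately have "g \<otimes> ?y \<in> forced G (g # gs) Q"
          using A(1,2) by (intro forced.mult[of ?y G "g # gs" Q g A "?c (int (Suc n))"]) simp_all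
        then show ?thesis using g xc by (simp add: mult_inv_cancel)
      qed
    qed
  qed
  \<comment> \<open>Every exponent reduces to its residue modulo \<open>e\<close>, which is
    nonnegative.\<close>
  have "?c k \<subseteq> forced G (g # gs) Q" for k
    by (subst mod) (use nat[of "nat (k mod e)"] e(1) in simp)
  then show thesis using that[OF fin disj un] P(4) unfolding Q_def by blast
qed

text \<open>Different exponents now give different cosets, so the sign of the exponent is well
  defined. Multiplication by \<open>g\<close> maps \<open>T\<close> and \<open>U\<close> into
  \<open>U\<close>, and multiplication by its inverse maps \<open>T\<close> and \<open>V\<close>
  into \<open>V\<close>. Thus two new blocks suffice for infinitely many cosets.\<close>

lemma forced_partition_infinite_index:
  assumes T: "T \<lhd> G" and g: "g \<in> carrier G" and e: "\<And>e :: int. e \<noteq> 0 \<Longrightarrow> g [^] e \<notin> T"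
    and P: "finite P" "disjoint P" "\<Union>P = T" "{\<one>} \<in> P" "T \<subseteq> forced G gs P"
  obtains Q where "finite Q" "disjoint Q" "\<Union>Q = (\<Union>k. power_coset G g T k)" "{\<one>} \<in> Q"
    "(\<Union>k. power_coset G g T k) \<subseteq> forced G (g # gs) Q"
proof -
  let ?c = "power_coset G g T"
  define U where "U = (\<Union>k\<in>{0<..}. ?c k)"
  define V where "V = (\<Union>k\<in>{..<0}. ?c k)"
  define Q where "Q = P \<union> {U, V}"
  have dis: "k = l" if "x \<in> ?c k" "x \<in> ?c l" for k l x
    using e[of "k - l"] power_coset_disjoint[OF T g that] by (cases "k = l") simp_all
  have c0: "?c 0 = T" using T by simp
  have fin: "finite Q" using P(1) by (simp add: Q_def)
  have disj_UN: "(\<Union>k\<in>K. ?c k) \<inter> (\<Union>k\<in>L. ?c k) = {}" if KL: "K \<inter> L = {}" for K L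
  proof (rule ccontr)
    assume "(\<Union>k\<in>K. ?c k) \<inter> (\<Union>k\<in>L. ?c k) \<noteq> {}"
    then obtain x k l where "k \<in> K" "l \<in> L" "x \<in> ?c k" "x \<in> ?c l" by blast
    moreover from this have "k = l" by (intro dis)
    ultimately show False using KL by blast
  qed
  have "{0<..} \<inter> {..<0 :: int} = {}" by auto
  then have UV: "U \<inter> V = {}" "T \<inter> U = {}" "T \<inter> V = {}"
    using disj_UN[of "{0<..}" "{..<0}"] disj_UN[of "{0}" "{0<..}"] disj_UN[of "{0}" "{..<0}"] c0
    unfolding U_def V_def by auto
  have disj: "disjoint Q"
    unfolding Q_def
  proof (rule disjoint_union)
    show "disjoint {U, V}" using UV(1) by (auto simp: disjoint_def)
    show "\<Union>P \<inter> \<Union>{U, V} = {}" using P(3) UV(2,3) by auto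
  qed (rule P(2))
  have un: "\<Union>Q = (\<Union>k. ?c k)"
  proof (rule equalityI)
    show "\<Union>Q \<subseteq> (\<Union>k. ?c k)" unfolding Q_def U_def V_def using P(3) c0 by auto
    show "(\<Union>k. ?c k) \<subseteq> \<Union>Q"
    proof
      fix x assume "x \<in> (\<Union>k. ?c k)"
      then obtain k where k: "x \<in> ?c k" by blast
      consider "k = 0" | "k > 0" | "k < 0" by linarith
      then show "x \<in> \<Union>Q"
        by cases (use k c0 P(3) in \<open>auto simp: Q_def U_def V_def\<close>)
    qed
  qed
  have TQ: "T \<subseteq> forced G (g # gs) Q"
  proof
    fix x assume "x \<in> T"
    then have "x \<in> forced G gs P" using P(5) by blast
    then show "x \<in> forced G (g # gs) Q" by (rule forced_mono[rotated 2]) (auto simp: Q_def)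
  qed
  have pos: "?c (int n) \<subseteq> forced G (g # gs) Q" for n
  proof (induction n)
    case 0
    then show ?case using TQ c0 by simp
  next
    case (Suc n)
    show ?case
    proof
      fix x assume x: "x \<in> ?c (int (Suc n))"
      let ?y = "inv g \<otimes> x"
      have xc: "x \<in> carrier G" using power_coset_closed[OF T g x] .
      have y: "?y \<in> ?c (int n)" using power_coset_step(2)[OF T g x] by simp
      \<comment> \<open>The step starts in a block of \<open>P\<close> if the exponent is zero and
        in \<open>U\<close> otherwise. Either block has only nonnegative exponents, so one step by
        \<open>g\<close> ends in \<open>U\<close>.\<close>
      obtain A where A: "A \<in> Q" "?y \<in> A" "A \<subseteq> (\<Union>k\<in>{0..}. ?c k)"
      proof (cases "n = 0")
        case True
        then have "?y \<in> T" using y c0 by simp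
        then obtain A where "A \<in> P" "?y \<in> A" using P(3) by blast
        moreover from this have "A \<subseteq> ?c 0" using P(3) c0 by blast
        ultimately show thesis using that[of A] unfolding Q_def by auto
      next
        case False
        then have "?y \<in> U" using y unfolding U_def by auto
        moreover have "U \<in> Q" unfolding Q_def by blast
        moreover have "U \<subseteq> (\<Union>k\<in>{0..}. ?c k)" unfolding U_def by (rule UN_mono) auto
        ultimately show thesis using that[of U] by blast
      qed
      have "g \<otimes> a \<in> U" if aA: "a \<in> A" for a
      proof -
        obtain k where "k \<ge> 0" "a \<in> ?c k" using aA A(3) by auto
        then show ?thesis using power_coset_step(1)[OF T g, of a k] unfolding U_def by auto
      qed
      moreover have "U \<in> Q" unfolding Q_def by blast
      moreover have "?y \<in> forced G (g # gs) Q" using y Suc by blast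
      ultimately have "g \<otimes> ?y \<in> forced G (g # gs) Q"
        using A(1,2) by (intro forced.mult[of ?y G "g # gs" Q g A U]) simp_all
      then show "x \<in> forced G (g # gs) Q" using g xc by (simp add: mult_inv_cancel)
    qed
  qed
  have neg: "?c (- int n) \<subseteq> forced G (g # gs) Q" for n
  proof (induction n)
    case 0
    then show ?case using TQ c0 by simp
  next
    case (Suc n)
    show ?case
    proof
      fix x assume x: "x \<in> ?c (- int (Suc n))"
      let ?y = "g \<otimes> x"
      have xc: "x \<in> carrier G" using power_coset_closed[OF T g x] .
      have y: "?y \<in> ?c (- int n)" using power_coset_step(1)[OF T g x] by simp
      obtain A where A: "A \<in> Q" "?y \<in> A" "A \<subseteq> (\<Union>k\<in>{..0}. ?c k)"
      proof (cases "n = 0")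
        case True
        then have "?y \<in> T" using y c0 by simp
        then obtain A where "A \<in> P" "?y \<in> A" using P(3) by blast
        moreover from this have "A \<subseteq> ?c 0" using P(3) c0 by blast
        ultimately show thesis using that[of A] unfolding Q_def by auto
      next
        case False
        then have "?y \<in> V" using y unfolding V_def by auto
        moreover have "V \<in> Q" unfolding Q_def by blast
        moreover have "V \<subseteq> (\<Union>k\<in>{..0}. ?c k)" unfolding V_def by (rule UN_mono) auto
        ultimately show thesis using that[of V] by blast
      qed
      have "inv g \<otimes> a \<in> V" if aA: "a \<in> A" for a
      proof -
        obtain k where "k \<le> 0" "a \<in> ?c k" using aA A(3) by auto
        then show ?thesis using power_coset_step(2)[OF T g, of a k] unfolding V_def by auto
      qed
      moreover have "V \<in> Q" unfolding Q_def by blast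
      moreover have "?y \<in> forced G (g # gs) Q" using y Suc by blast
      ultimately have "inv g \<otimes> ?y \<in> forced G (g # gs) Q"
        using A(1,2) by (intro forced.inv_mult[of ?y G "g # gs" Q g A V]) simp_all
      then show "x \<in> forced G (g # gs) Q" using g xc by (simp add: mult_inv_cancel)
    qed
  qed
  have "?c k \<subseteq> forced G (g # gs) Q" for k
    using pos[of "nat k"] neg[of "nat (- k)"] by (cases "k \<ge> 0") simp_all
  then show thesis using that[OF fin disj un] P(4) unfolding Q_def by blast
qed

text \<open>The block \<open>{\<one>}\<close> is what later allows the identity to be recognised by
  its colour.\<close>

lemma forced_partition:
  assumes "cyclic_series G gs S"
  shows "\<exists>P. finite P \<and> disjoint P \<and> \<Union>P = S \<and> {\<one>} \<in> P \<and> S \<subseteq> forced G gs P"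
  using assms
proof induction
  case trivial
  show ?case
    by (intro exI[of _ "{{\<one>}}"]) (auto intro: forced.one)
next
  case (extend gs T g)
  then obtain P where P: "finite P" "disjoint P" "\<Union>P = T" "{\<one>} \<in> P" "T \<subseteq> forced G gs P"
    by blast
  show ?case
  proof (cases "\<exists>e :: int. e \<noteq> 0 \<and> g [^] e \<in> T")
    case True
    then obtain e :: int where e: "e \<noteq> 0" "g [^] e \<in> T" by blast
    \<comment> \<open>\<open>forced_partition_finite_index\<close> asks for a positive
      exponent.\<close>
    have "g [^] \<bar>e\<bar> \<in> T"
    proof (cases "e > 0")
      case False
      have "g [^] (- e) = inv (g [^] e)" using extend.hyps(3) by (rule int_pow_neg)
      with False show ?thesis
        using subgroup.m_inv_closed[OF normal_imp_subgroup[OF extend.hyps(2)] e(2)] by simp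
    qed (use e in simp)
    moreover have "\<bar>e\<bar> > 0" using e(1) by simp
    ultimately obtain Q where "finite Q" "disjoint Q" "\<Union>Q = (\<Union>k. power_coset G g T k)"
      "{\<one>} \<in> Q" "(\<Union>k. power_coset G g T k) \<subseteq> forced G (g # gs) Q"
      using forced_partition_finite_index[OF extend.hyps(2,3) _ _ P] by blast
    then show ?thesis by blast
  next
    case False
    then have "\<And>e :: int. e \<noteq> 0 \<Longrightarrow> g [^] e \<notin> T" by blast
    then obtain Q where "finite Q" "disjoint Q" "\<Union>Q = (\<Union>k. power_coset G g T k)"
      "{\<one>} \<in> Q" "(\<Union>k. power_coset G g T k) \<subseteq> forced G (g # gs) Q"
      using forced_partition_infinite_index[OF extend.hyps(2,3) _ P] by blast
    then show ?thesis by blast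
  qed
qed

end

section \<open>Relations\<close>

text \<open>The tuple of all coordinate projections of a power of \<open>H\<close> generates the relatively free group
  of the variety of \<open>H\<close>. It is of class at most 2, so the subgroup of the relations of \<open>gs\<close> in it is
  finitely generated. The point is that \<open>R\<close> does not depend on \<open>hs\<close>.\<close>

lemma finite_relation_basis:
  assumes "group G" "group H" "commutators_central H" "set gs \<subseteq> carrier G"
  obtains R where "finite R" "R \<subseteq> words (length gs)" "\<And>r. r \<in> R \<Longrightarrow> word_val G gs r = \<one>\<^bsub>G\<^esub>"
    "\<And>hs w. length hs = length gs \<Longrightarrow> set hs \<subseteq> carrier H \<Longrightarrow> w \<in> words (length gs) \<Longrightarrow>
       word_val G gs w = \<one>\<^bsub>G\<^esub> \<Longrightarrow> word_val H hs w \<in> generate H (word_val H hs ` R)"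
proof -
  interpret G: group G by fact
  interpret H: group H by fact
  define p where "p = length gs"
  \<comment> \<open>\<open>I\<close> is the set of all \<open>p\<close>-tuples in \<open>H\<close>.
    The coordinate projections \<open>ps\<close> on \<open>I\<close> generate the relatively free
    group \<open>F0\<close>, so a word in them records its values at all tuples at once.\<close>
  define I where "I = {hs. length hs = p \<and> set hs \<subseteq> carrier H}"
  define F where "F = product_group I (\<lambda>_. H)"
  define ps where "ps = map (\<lambda>i. \<lambda>hs\<in>I. hs ! i) [0..<p]"
  define F0 where "F0 = subgroup_generated F (set ps)"
  interpret F: group F unfolding F_def by (rule product_group) (rule H.is_group)
  interpret F0: group F0 unfolding F0_def by (rule F.group_subgroup_generated)
  have "(\<lambda>hs\<in>I. hs ! i) \<in> carrier F" if "i < p" for i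
    unfolding F_def carrier_product_group restrict_PiE_iff using that by (simp add: I_def)
  then have psc: "set ps \<subseteq> carrier F" unfolding ps_def by auto
  have lps: "length ps = p" by (simp add: ps_def)
  have F0c: "carrier F0 = generate F (set ps)"
    unfolding F0_def carrier_subgroup_generated using psc by (simp add: Int_absorb1)
  have F0F: "carrier F0 \<subseteq> carrier F" unfolding F0c using psc by (rule F.generate_incl)
  have ps0: "set ps \<subseteq> carrier F0" unfolding F0c by (auto intro: generate.incl)
  have multF: "(f \<otimes>\<^bsub>F0\<^esub> g) = (\<lambda>hs\<in>I. f hs \<otimes>\<^bsub>H\<^esub> g hs)" for f g
    by (simp add: F0_def F_def)
  have invF: "inv\<^bsub>F0\<^esub> f = (\<lambda>hs\<in>I. inv\<^bsub>H\<^esub> (f hs))" if "f \<in> carrier F0" for f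
  proof -
    have "inv\<^bsub>F0\<^esub> f = inv\<^bsub>F\<^esub> f" using that unfolding F0_def by (rule F.inv_subgroup_generated)
    also have "\<dots> = (\<lambda>hs\<in>I. inv\<^bsub>H\<^esub> (f hs))"
      unfolding F_def by (rule inv_product_group) (use that F0F in \<open>auto simp: F_def H.is_group\<close>)
    finally show ?thesis .
  qed
  have oneF: "\<one>\<^bsub>F0\<^esub> = (\<lambda>hs\<in>I. \<one>\<^bsub>H\<^esub>)" by (simp add: F0_def F_def)
  have F0ext: "f hs \<in> carrier H" if "f \<in> carrier F0" "hs \<in> I" for f hs
  proof -
    have "f \<in> carrier F" using that(1) F0F by blast
    then show ?thesis using that(2) by (auto simp: F_def)
  qed
  have val: "word_val F0 ps w hs = word_val H hs w" if "w \<in> words p" and hs: "hs \<in> I" for w hs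
    using that(1)
  proof (induction w)
    case Nil
    then show ?case using hs by (simp add: oneF)
  next
    case (Cons l w)
    then have l: "snd l < p" by simp
    have "ps ! snd l = (\<lambda>hs\<in>I. hs ! snd l)" using l by (simp add: ps_def)
    moreover have "ps ! snd l \<in> carrier F0" using l ps0 lps by simp
    ultimately show ?case using Cons hs by (simp add: multF invF)
  qed
  have gen0: "generate F0 (set ps) = carrier F0"
  proof -
    have "carrier (subgroup_generated F0 (set ps)) = carrier F0" by (simp add: F0_def)
    then show ?thesis unfolding carrier_subgroup_generated using ps0 by (simp add: Int_absorb1)
  qed
  have "commutators_central F0"
    unfolding commutators_central_def
  proof (intro ballI)
    fix x y assume x: "x \<in> carrier F0" and y: "y \<in> carrier F0"
    let ?c = "x \<otimes>\<^bsub>F0\<^esub> y \<otimes>\<^bsub>F0\<^esub> inv\<^bsub>F0\<^esub> x \<otimes>\<^bsub>F0\<^esub> inv\<^bsub>F0\<^esub> y"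
    have "?c \<otimes>\<^bsub>F0\<^esub> z = z \<otimes>\<^bsub>F0\<^esub> ?c" if z: "z \<in> carrier F0" for z
      unfolding multF invF[OF x] invF[OF y]
    proof (rule restrict_ext)
      fix hs assume hs: "hs \<in> I"
      have "x hs \<otimes>\<^bsub>H\<^esub> y hs \<otimes>\<^bsub>H\<^esub> inv\<^bsub>H\<^esub> (x hs) \<otimes>\<^bsub>H\<^esub> inv\<^bsub>H\<^esub> (y hs) \<in> center_set H"
        using assms(3) F0ext[OF x hs] F0ext[OF y hs] unfolding commutators_central_def by blast
      from H.center_set_commute[OF this F0ext[OF z hs]] hs
      show "(\<lambda>hs\<in>I. (\<lambda>hs\<in>I. (\<lambda>hs\<in>I. x hs \<otimes>\<^bsub>H\<^esub> y hs) hs \<otimes>\<^bsub>H\<^esub> (\<lambda>hs\<in>I. inv\<^bsub>H\<^esub> x hs) hs) hs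
          \<otimes>\<^bsub>H\<^esub> (\<lambda>hs\<in>I. inv\<^bsub>H\<^esub> y hs) hs) hs \<otimes>\<^bsub>H\<^esub> z hs
        = z hs \<otimes>\<^bsub>H\<^esub> (\<lambda>hs\<in>I. (\<lambda>hs\<in>I. (\<lambda>hs\<in>I. x hs \<otimes>\<^bsub>H\<^esub> y hs) hs \<otimes>\<^bsub>H\<^esub> (\<lambda>hs\<in>I. inv\<^bsub>H\<^esub> x hs) hs) hs
          \<otimes>\<^bsub>H\<^esub> (\<lambda>hs\<in>I. inv\<^bsub>H\<^esub> y hs) hs) hs" by simp
    qed
    with x y show "?c \<in> center_set F0" unfolding center_set_def by simp
  qed
  then obtain fs where series: "cyclic_series F0 fs (carrier F0)"
    using F0.cyclic_series_class2[OF _ ps0 gen0] by blast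
  \<comment> \<open>\<open>N\<close> consists of the relations of \<open>gs\<close>. Concatenation
    and \<open>word_inv\<close> make its image in \<open>F0\<close> a subgroup.\<close>
  define N where "N = {w \<in> words p. word_val G gs w = \<one>\<^bsub>G\<^esub>}"
  have "subgroup (word_val F0 ps ` N) F0"
  proof (rule F0.subgroupI)
    show "word_val F0 ps ` N \<subseteq> carrier F0"
      using ps0 lps by (auto simp: N_def)
    have "[] \<in> N" by (simp add: N_def)
    then show "word_val F0 ps ` N \<noteq> {}" by blast
    show "inv\<^bsub>F0\<^esub> a \<in> word_val F0 ps ` N" if a: "a \<in> word_val F0 ps ` N" for a
    proof -
      obtain w where w: "w \<in> N" "a = word_val F0 ps w" using a by blast
      then have "inv\<^bsub>F0\<^esub> a = word_val F0 ps (word_inv w)"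
        using F0.word_val_inv[OF ps0, of w] lps by (simp add: N_def)
      moreover have "word_inv w \<in> N"
        using w(1) G.word_val_inv[OF assms(4), of w] by (simp add: N_def p_def)
      ultimately show ?thesis by blast
    qed
    show "a \<otimes>\<^bsub>F0\<^esub> b \<in> word_val F0 ps ` N"
      if ab: "a \<in> word_val F0 ps ` N" "b \<in> word_val F0 ps ` N" for a b
    proof -
      obtain v w where vw: "v \<in> N" "a = word_val F0 ps v" "w \<in> N" "b = word_val F0 ps w"
        using ab by blast
      then have "a \<otimes>\<^bsub>F0\<^esub> b = word_val F0 ps (v @ w)"
        using F0.word_val_append[OF ps0, of v w] lps by (simp add: N_def)
      moreover have "v @ w \<in> N"
        using vw(1,3) G.word_val_append[OF assms(4), of v w] by (simp add: N_def p_def)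
      ultimately show ?thesis by blast
    qed
  qed
  then obtain Y where Y: "finite Y" "Y \<subseteq> word_val F0 ps ` N" "word_val F0 ps ` N = generate F0 Y"
    using F0.subgroup_finite_generating_set[OF series _ subgroup.subset] by blast
  \<comment> \<open>The finitely many generators in \<open>F0\<close> are represented by
    words.\<close>
  obtain R where R: "R \<subseteq> N" "finite R" "Y = word_val F0 ps ` R"
    using finite_subset_image[OF Y(1,2)] by blast
  show thesis
  proof (rule that[OF R(2)])
    show "R \<subseteq> words (length gs)" using R(1) by (auto simp: N_def p_def)
    show "word_val G gs r = \<one>\<^bsub>G\<^esub>" if "r \<in> R" for r using R(1) that by (auto simp: N_def)
    fix hs w assume "length hs = length gs" "set hs \<subseteq> carrier H" and w: "w \<in> words (length gs)"
      "word_val G gs w = \<one>\<^bsub>G\<^esub>"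
    then have hs: "hs \<in> I" by (simp add: I_def p_def)
    have wN: "w \<in> N" using w by (simp add: N_def p_def)
    \<comment> \<open>Evaluation at the tuple \<open>hs\<close> carries the generators
      \<open>Y\<close> to the values of \<open>R\<close> at \<open>hs\<close>.\<close>
    have "(\<lambda>f. f hs) \<in> hom F0 H"
      by (rule homI) (use F0ext hs multF in auto)
    then interpret ev: group_hom F0 H "\<lambda>f. f hs" by unfold_locales
    have YF: "Y \<subseteq> carrier F0" using Y(2) ps0 lps by (auto simp: N_def)
    have "word_val F0 ps w \<in> generate F0 Y" using wN Y(3) by blast
    then have "word_val F0 ps w hs \<in> (\<lambda>f. f hs) ` generate F0 Y" by (rule imageI)
    also have "\<dots> = generate H ((\<lambda>f. f hs) ` Y)" by (rule ev.generate_img[OF YF, symmetric])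
    also have "(\<lambda>f. f hs) ` Y = word_val H hs ` R"
      unfolding R(3) image_image using R(1) by (intro image_cong) (auto simp: N_def val[OF _ hs])
    also have "word_val F0 ps w hs = word_val H hs w" using wN by (simp add: N_def val[OF _ hs])
    finally show "word_val H hs w \<in> generate H (word_val H hs ` R)" .
  qed
qed

section \<open>Configuration equivalence\<close>

text \<open>If a commutator in \<open>H\<close> fails to commute with \<open>c\<close>, two words
  have different values. A colouring that singles out every vertex on their paths transfers this
  difference to \<open>G\<close>, where the two words agree.\<close>

lemma commutators_central_transfer:
  assumes "group G" "group H" "commutators_central G" "finitely_generated H" "Con H \<subseteq> Con G"
  shows "commutators_central H"
proof (rule ccontr)
  interpret G: group G by fact
  interpret H: group H by fact
  assume "\<not> commutators_central H"
  then obtain a b c where abc: "a \<in> carrier H" "b \<in> carrier H" "c \<in> carrier H"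
    and ne: "a \<otimes>\<^bsub>H\<^esub> b \<otimes>\<^bsub>H\<^esub> inv\<^bsub>H\<^esub> a \<otimes>\<^bsub>H\<^esub> inv\<^bsub>H\<^esub> b \<otimes>\<^bsub>H\<^esub> c
       \<noteq> c \<otimes>\<^bsub>H\<^esub> (a \<otimes>\<^bsub>H\<^esub> b \<otimes>\<^bsub>H\<^esub> inv\<^bsub>H\<^esub> a \<otimes>\<^bsub>H\<^esub> inv\<^bsub>H\<^esub> b)"
    unfolding commutators_central_def center_set_def by auto
  obtain ks where ks: "set ks \<subseteq> carrier H" "generate H (set ks) = carrier H"
    using assms(4) finite_list unfolding finitely_generated_def by blast
  \<comment> \<open>The three elements come first, so that \<open>v\<close> and \<open>w\<close> are
    words in the letters 0, 1 and 2.\<close>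
  define hs where "hs = a # b # c # ks"
  have hsc: "set hs \<subseteq> carrier H" using abc ks(1) by (simp add: hs_def)
  have "carrier H \<subseteq> generate H (set hs)"
    using H.mono_generate[of "set ks" "set hs"] ks(2) by (auto simp: hs_def)
  then have hsg: "generating_seq H hs"
    using hsc H.generate_incl[OF hsc] by (simp add: generating_seq_def subset_antisym)
  define v :: "(bool \<times> nat) list"
    where "v = [(True, 0), (True, 1), (False, 0), (False, 1), (True, 2)]"
  define w :: "(bool \<times> nat) list"
    where "w = [(True, 2), (True, 0), (True, 1), (False, 0), (False, 1)]"
  have words: "v \<in> words (length hs)" "w \<in> words (length hs)"
    by (simp_all add: v_def w_def hs_def)
  have vw: "word_val H hs v \<noteq> word_val H hs w"
    using ne abc by (simp add: v_def w_def hs_def H.m_assoc)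
  define B where "B = word_val H hs ` (set (suffixes v) \<union> set (suffixes w))"
  \<comment> \<open>All elements off the two paths share the colour \<open>None\<close>, which keeps
    the number of colours finite.\<close>
  define \<chi> where "\<chi> x = (if x \<in> B then Some x else None)" for x
  have B: "word_val H hs u \<in> B" if "suffix u v \<or> suffix u w" for u
    unfolding B_def by (rule imageI) (use that in auto)
  have "\<chi> ` carrier H \<subseteq> insert None (Some ` B)" by (auto simp: \<chi>_def)
  then have fin: "finite (\<chi> ` carrier H)" by (rule finite_subset) (simp add: B_def)
  obtain gs \<chi>' where gs: "generating_seq G gs" "length gs = length hs"
    and cover: "\<forall>x\<in>carrier H. \<exists>y\<in>carrier G. \<chi>' y = \<chi> x \<and>
           (\<forall>i<length hs. \<chi>' (gs ! i \<otimes>\<^bsub>G\<^esub> y) = \<chi> (hs ! i \<otimes>\<^bsub>H\<^esub> x))"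
    and match: "\<forall>y\<in>carrier G. \<exists>x\<in>carrier H. \<chi>' y = \<chi> x \<and>
           (\<forall>i<length hs. \<chi>' (gs ! i \<otimes>\<^bsub>G\<^esub> y) = \<chi> (hs ! i \<otimes>\<^bsub>H\<^esub> x))"
    by (rule Con_colouring_transfer[OF assms(2,1,5) hsg fin])
  have gsc: "set gs \<subseteq> carrier G" using gs(1) by (simp add: generating_seq_def)
  obtain y where y: "y \<in> carrier G" "\<chi>' y = \<chi> \<one>\<^bsub>H\<^esub>" using bspec[OF cover H.one_closed] by blast
  have colour: "\<chi>' (word_val G gs u \<otimes>\<^bsub>G\<^esub> y) = Some (word_val H hs u)" if u: "u = v \<or> u = w" for u
  proof -
    have "\<chi>' (word_val G gs u \<otimes>\<^bsub>G\<^esub> y) = \<chi> (word_val H hs u)"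
    proof (rule colour_of_word[OF assms(2,1) hsc gsc gs(2) match _ _ y])
      show "u \<in> words (length hs)" using u words by blast
      fix t x assume t: "suffix t u" and x: "\<chi> x = \<chi> (word_val H hs t)"
      have "word_val H hs t \<in> B" using B t u by blast
      with x show "x = word_val H hs t" by (auto simp: \<chi>_def split: if_splits)
    qed
    moreover have "word_val H hs u \<in> B" using B[of u] u by auto
    ultimately show ?thesis by (simp add: \<chi>_def)
  qed
  have "gs ! 0 \<in> carrier G" "gs ! 1 \<in> carrier G" "gs ! 2 \<in> carrier G"
    using gsc gs(2) by (simp_all add: hs_def)
  moreover from this have "gs ! 0 \<otimes>\<^bsub>G\<^esub> gs ! 1 \<otimes>\<^bsub>G\<^esub> inv\<^bsub>G\<^esub> (gs ! 0) \<otimes>\<^bsub>G\<^esub> inv\<^bsub>G\<^esub> (gs ! 1) \<in> center_set G"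
    using assms(3) unfolding commutators_central_def by blast
  ultimately have "word_val G gs v = word_val G gs w"
    using G.center_set_commute[of "gs ! 0 \<otimes>\<^bsub>G\<^esub> gs ! 1 \<otimes>\<^bsub>G\<^esub> inv\<^bsub>G\<^esub> (gs ! 0) \<otimes>\<^bsub>G\<^esub> inv\<^bsub>G\<^esub> (gs ! 1)" "gs ! 2"]
    by (simp add: v_def w_def G.m_assoc)
  with colour[of v] colour[of w] vw show False by simp
qed

text \<open>The map goes against the inclusion: the colouring is chosen on \<open>G\<close>, and
  every relation of the resulting \<open>hs\<close> turns out to be a relation of
  \<open>gs\<close>.\<close>

lemma epimorphism_from_Con_subset:
  assumes "group G" "group H" "cyclic_series G gs (carrier G)" "commutators_central H" "Con G \<subseteq> Con H"
  obtains \<phi> where "\<phi> \<in> hom H G" "\<phi> ` carrier H = carrier G"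
proof -
  interpret G: group G by fact
  interpret H: group H by fact
  define p where "p = length gs"
  have gsc: "set gs \<subseteq> carrier G" and "carrier G \<subseteq> generate G (set gs)"
    using G.cyclic_series_subgroup[OF assms(3)] by blast+
  then have gsg: "generating_seq G gs"
    using G.generate_incl[OF gsc] by (simp add: generating_seq_def subset_antisym)
  \<comment> \<open>\<open>R\<close> must be available before \<open>hs\<close>, because the
    colouring that yields \<open>hs\<close> is built from it.\<close>
  obtain R where R: "finite R" "R \<subseteq> words p" "\<And>r. r \<in> R \<Longrightarrow> word_val G gs r = \<one>\<^bsub>G\<^esub>"
    and Rgen: "\<And>hs w. length hs = p \<Longrightarrow> set hs \<subseteq> carrier H \<Longrightarrow> w \<in> words p \<Longrightarrow>
       word_val G gs w = \<one>\<^bsub>G\<^esub> \<Longrightarrow> word_val H hs w \<in> generate H (word_val H hs ` R)"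
    using finite_relation_basis[OF assms(1,2,4) gsc] unfolding p_def by blast
  obtain P where P: "finite P" "disjoint P" "\<Union>P = carrier G" "{\<one>\<^bsub>G\<^esub>} \<in> P"
    and forced: "carrier G \<subseteq> forced G gs P"
    using G.forced_partition[OF assms(3)] by blast
  define block where "block x = (THE A. A \<in> P \<and> x \<in> A)" for x
  have block_eq: "block x = A" if "A \<in> P" "x \<in> A" for x A
    unfolding block_def
  proof (rule the_equality)
    show "A \<in> P \<and> x \<in> A" using that by blast
    show "C = A" if "C \<in> P \<and> x \<in> C" for C
      using P(2) that \<open>A \<in> P\<close> \<open>x \<in> A\<close> unfolding disjoint_def by blast
  qed
  have block: "block x \<in> P" "x \<in> block x" if x: "x \<in> carrier G" for x
  proof -
    obtain A where A: "A \<in> P" "x \<in> A" using x P(3) by blast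
    then show "block x \<in> P" "x \<in> block x" using block_eq[OF A] by simp_all
  qed
  \<comment> \<open>Inverse loops are included since the subgroup generated by the values of
    \<open>R\<close> contains inverses.\<close>
  define B where "B = word_val G gs ` (\<Union>r\<in>R. set (suffixes r) \<union> set (suffixes (word_inv r)))"
  have finB: "finite B" using R(1) by (simp add: B_def)
  have BI: "word_val G gs u \<in> B" if "r \<in> R" "suffix u r \<or> suffix u (word_inv r)" for r u
    unfolding B_def by (rule imageI) (use that in auto)
  \<comment> \<open>The first component guides the forced paths; the second identifies the vertices
    of the loops.\<close>
  define \<chi> where "\<chi> x = (block x, if x \<in> B then Some x else None)" for x
  have "\<chi> ` carrier G \<subseteq> P \<times> insert None (Some ` B)"
    using block(1) by (auto simp: \<chi>_def)
  then have fin: "finite (\<chi> ` carrier G)" by (rule finite_subset) (simp add: P(1) finB)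
  obtain hs \<chi>' where hs: "generating_seq H hs" "length hs = length gs"
    and cover: "\<forall>x\<in>carrier G. \<exists>y\<in>carrier H. \<chi>' y = \<chi> x \<and>
           (\<forall>i<length gs. \<chi>' (hs ! i \<otimes>\<^bsub>H\<^esub> y) = \<chi> (gs ! i \<otimes>\<^bsub>G\<^esub> x))"
    and match: "\<forall>y\<in>carrier H. \<exists>x\<in>carrier G. \<chi>' y = \<chi> x \<and>
           (\<forall>i<length gs. \<chi>' (hs ! i \<otimes>\<^bsub>H\<^esub> y) = \<chi> (gs ! i \<otimes>\<^bsub>G\<^esub> x))"
    by (rule Con_colouring_transfer[OF assms(1,2,5) gsg fin])
  have hsc: "set hs \<subseteq> carrier H" and hsg: "generate H (set hs) = carrier H"
    using hs(1) by (simp_all add: generating_seq_def)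
  have lhs: "length hs = p" using hs(2) by (simp add: p_def)
  have Hval: "word_val H hs w \<in> carrier H" if "w \<in> words p" for w
    using that hsc lhs by simp
  have Gval: "word_val G gs w \<in> carrier G" if "w \<in> words p" for w
    using that gsc p_def by simp
  \<comment> \<open>Several elements of \<open>H\<close> may have the colour of the identity. The
    loops are shown to preserve this set, not its single elements.\<close>
  define seeds where "seeds = {y \<in> carrier H. \<chi>' y = \<chi> \<one>\<^bsub>G\<^esub>}"
  obtain y0 where y0: "y0 \<in> seeds" using bspec[OF cover G.one_closed] unfolding seeds_def by blast
  have loop: "word_val H hs u \<otimes>\<^bsub>H\<^esub> y \<in> seeds"
    if y: "y \<in> seeds" and r: "r \<in> R" and u: "u = r \<or> u = word_inv r" for y r u
  proof -
    have rp: "r \<in> words p" using r R(2) by blast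
    have up: "u \<in> words p" using u rp by auto
    have u1: "word_val G gs u = \<one>\<^bsub>G\<^esub>"
      using u R(3)[OF r] G.word_val_inv[OF gsc, of r] rp by (auto simp: p_def)
    have yc: "y \<in> carrier H" "\<chi>' y = \<chi> \<one>\<^bsub>G\<^esub>" using y by (simp_all add: seeds_def)
    have "\<chi>' (word_val H hs u \<otimes>\<^bsub>H\<^esub> y) = \<chi> (word_val G gs u)"
    proof (rule colour_of_word[OF assms(1,2) gsc hsc hs(2) match _ _ yc])
      show "u \<in> words (length gs)" using up by (simp add: p_def)
      fix t x assume t: "suffix t u" and x: "\<chi> x = \<chi> (word_val G gs t)"
      have "word_val G gs t \<in> B" using BI[OF r] t u by blast
      with x show "x = word_val G gs t" by (auto simp: \<chi>_def split: if_splits)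
    qed
    then show ?thesis using u1 Hval[OF up] yc(1) by (simp add: seeds_def)
  qed
  have stable: "\<forall>y\<in>seeds. z \<otimes>\<^bsub>H\<^esub> y \<in> seeds" if "z \<in> generate H (word_val H hs ` R)" for z
    using that
  proof induction
    case one
    then show ?case by (simp add: seeds_def)
  next
    case (incl h)
    then show ?case using loop by blast
  next
    case (inv h)
    then obtain r where r: "r \<in> R" "h = word_val H hs r" by blast
    have "inv\<^bsub>H\<^esub> h = word_val H hs (word_inv r)"
      unfolding r(2) using H.word_val_inv[OF hsc, of r] r(1) R(2) lhs by auto
    then show ?case using loop r(1) by simp
  next
    case (eng h1 h2)
    have RH: "word_val H hs ` R \<subseteq> carrier H" using R(2) Hval by blast
    show ?case
    proof
      fix y assume y: "y \<in> seeds"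
      then have "h2 \<otimes>\<^bsub>H\<^esub> y \<in> seeds" using eng.IH(2) by blast
      then have "h1 \<otimes>\<^bsub>H\<^esub> (h2 \<otimes>\<^bsub>H\<^esub> y) \<in> seeds" using eng.IH(1) by blast
      moreover have "h1 \<in> carrier H" "h2 \<in> carrier H" "y \<in> carrier H"
        using eng.hyps H.generate_in_carrier[OF RH] y by (auto simp: seeds_def)
      ultimately show "h1 \<otimes>\<^bsub>H\<^esub> h2 \<otimes>\<^bsub>H\<^esub> y \<in> seeds" by (simp add: H.m_assoc)
    qed
  qed
  \<comment> \<open>The word \<open>v\<close> depends on \<open>x\<close> but not on the seed. Only
    the block is followed, as vertices outside \<open>B\<close> have no colour of their own.\<close>
  have path: "\<exists>v\<in>words p. word_val G gs v = x \<and>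
      (\<forall>y\<in>seeds. fst (\<chi>' (word_val H hs v \<otimes>\<^bsub>H\<^esub> y)) = block x)" if "x \<in> forced G gs P" for x
    using that
  proof induction
    case one
    show ?case by (rule bexI[of _ "[]"]) (auto simp: seeds_def \<chi>_def)
  next
    case (mult x g A C)
    obtain v where v: "v \<in> words p" "word_val G gs v = x"
      "\<And>y. y \<in> seeds \<Longrightarrow> fst (\<chi>' (word_val H hs v \<otimes>\<^bsub>H\<^esub> y)) = block x"
      using mult.IH by blast
    obtain i where i: "i < p" "gs ! i = g" using mult.hyps(2) by (auto simp: in_set_conv_nth p_def)
    have hi: "hs ! i \<in> carrier H" using i(1) lhs hsc by simp
    show ?case
    proof (intro bexI[of _ "(True, i) # v"] conjI ballI)
      show "(True, i) # v \<in> words p" using i v by simp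
      show "word_val G gs ((True, i) # v) = g \<otimes>\<^bsub>G\<^esub> x" using i v by simp
      fix y assume y: "y \<in> seeds"
      let ?z = "word_val H hs v \<otimes>\<^bsub>H\<^esub> y"
      have yc: "y \<in> carrier H" using y by (simp add: seeds_def)
      have zc: "?z \<in> carrier H" using Hval[OF v(1)] yc by simp
      \<comment> \<open>The partner \<open>x'\<close> may differ from \<open>x\<close>, but it lies
        in the same block \<open>A\<close>, and this decides the next block.\<close>
      obtain x' where x': "x' \<in> carrier G" "\<chi>' ?z = \<chi> x'"
        "\<chi>' (hs ! i \<otimes>\<^bsub>H\<^esub> ?z) = \<chi> (g \<otimes>\<^bsub>G\<^esub> x')"
        using bspec[OF match zc] i by (auto simp: p_def)
      have "block x' = A"
        using v(3)[OF y] x'(2) block_eq[OF mult.hyps(3,4)] by (simp add: \<chi>_def)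
      then have "g \<otimes>\<^bsub>G\<^esub> x' \<in> C" using mult.hyps(6) block(2)[OF x'(1)] by simp
      then have "fst (\<chi>' (hs ! i \<otimes>\<^bsub>H\<^esub> ?z)) = C"
        using x'(3) block_eq[OF mult.hyps(5)] by (simp add: \<chi>_def)
      moreover have "block (g \<otimes>\<^bsub>G\<^esub> x) = C"
        using mult.hyps(4,6) by (intro block_eq[OF mult.hyps(5)]) simp
      moreover have "word_val H hs ((True, i) # v) \<otimes>\<^bsub>H\<^esub> y = hs ! i \<otimes>\<^bsub>H\<^esub> ?z"
        using hi Hval[OF v(1)] yc by (simp add: H.m_assoc)
      ultimately show "fst (\<chi>' (word_val H hs ((True, i) # v) \<otimes>\<^bsub>H\<^esub> y)) = block (g \<otimes>\<^bsub>G\<^esub> x)"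
        by simp
    qed
  next
    case (inv_mult x g A C)
    obtain v where v: "v \<in> words p" "word_val G gs v = x"
      "\<And>y. y \<in> seeds \<Longrightarrow> fst (\<chi>' (word_val H hs v \<otimes>\<^bsub>H\<^esub> y)) = block x"
      using inv_mult.IH by blast
    obtain i where i: "i < p" "gs ! i = g" using inv_mult.hyps(2) by (auto simp: in_set_conv_nth p_def)
    have hi: "hs ! i \<in> carrier H" using i(1) lhs hsc by simp
    have gc: "g \<in> carrier G" using inv_mult.hyps(2) gsc by blast
    show ?case
    proof (intro bexI[of _ "(False, i) # v"] conjI ballI)
      show "(False, i) # v \<in> words p" using i v by simp
      show "word_val G gs ((False, i) # v) = inv\<^bsub>G\<^esub> g \<otimes>\<^bsub>G\<^esub> x" using i v by simp
      fix y assume y: "y \<in> seeds"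
      let ?z = "inv\<^bsub>H\<^esub> (hs ! i) \<otimes>\<^bsub>H\<^esub> (word_val H hs v \<otimes>\<^bsub>H\<^esub> y)"
      have yc: "y \<in> carrier H" using y by (simp add: seeds_def)
      have zc: "?z \<in> carrier H" using Hval[OF v(1)] yc hi by simp
      have hz: "hs ! i \<otimes>\<^bsub>H\<^esub> ?z = word_val H hs v \<otimes>\<^bsub>H\<^esub> y"
        using Hval[OF v(1)] yc hi by (simp add: H.mult_inv_cancel)
      \<comment> \<open>For an inverse letter the pattern is read at the end \<open>?z\<close> of
        the step: the block of the product of \<open>g\<close> and \<open>x'\<close> is known to be
        \<open>A\<close>, and it determines the block of \<open>x'\<close>.\<close>
      obtain x' where x': "x' \<in> carrier G" "\<chi>' ?z = \<chi> x'"
        "\<chi>' (hs ! i \<otimes>\<^bsub>H\<^esub> ?z) = \<chi> (g \<otimes>\<^bsub>G\<^esub> x')"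
        using bspec[OF match zc] i by (auto simp: p_def)
      have "block (g \<otimes>\<^bsub>G\<^esub> x') = A"
        using v(3)[OF y] x'(3) block_eq[OF inv_mult.hyps(3,4)] unfolding hz by (simp add: \<chi>_def)
      then have "inv\<^bsub>G\<^esub> g \<otimes>\<^bsub>G\<^esub> (g \<otimes>\<^bsub>G\<^esub> x') \<in> C"
        using inv_mult.hyps(6) block(2)[of "g \<otimes>\<^bsub>G\<^esub> x'"] gc x'(1) by simp
      then have "x' \<in> C" using gc x'(1) by (simp add: G.mult_inv_cancel)
      then have "fst (\<chi>' ?z) = C"
        using x'(2) block_eq[OF inv_mult.hyps(5)] by (simp add: \<chi>_def)
      moreover have "block (inv\<^bsub>G\<^esub> g \<otimes>\<^bsub>G\<^esub> x) = C"
        using inv_mult.hyps(4,6) by (intro block_eq[OF inv_mult.hyps(5)]) simp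
      moreover have "word_val H hs ((False, i) # v) \<otimes>\<^bsub>H\<^esub> y = ?z"
        using hi Hval[OF v(1)] yc by (simp add: H.m_assoc)
      ultimately show "fst (\<chi>' (word_val H hs ((False, i) # v) \<otimes>\<^bsub>H\<^esub> y)) = block (inv\<^bsub>G\<^esub> g \<otimes>\<^bsub>G\<^esub> x)"
        by simp
    qed
  qed
  have rel: "word_val G gs w = \<one>\<^bsub>G\<^esub>" if w: "w \<in> words p" "word_val H hs w = \<one>\<^bsub>H\<^esub>" for w
  proof -
    have "word_val G gs w \<in> forced G gs P" using forced Gval[OF w(1)] by blast
    then obtain v where v: "v \<in> words p" "word_val G gs v = word_val G gs w"
      "\<And>y. y \<in> seeds \<Longrightarrow> fst (\<chi>' (word_val H hs v \<otimes>\<^bsub>H\<^esub> y)) = block (word_val G gs w)"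
      using path by blast
    \<comment> \<open>\<open>?u\<close> is a relation of \<open>gs\<close>, so it moves
      \<open>y0\<close> to a seed. In \<open>H\<close> its value is inverse to that of
      \<open>v\<close>, because \<open>w\<close> is trivial there. Hence \<open>v\<close> leads from
      this seed back to \<open>y0\<close>, and the block of \<open>word_val G gs w\<close> is that
      of the identity.\<close>
    let ?u = "word_inv v @ w"
    have up: "?u \<in> words p" using v(1) w(1) by simp
    have "word_val G gs ?u = \<one>\<^bsub>G\<^esub>"
      using v(1,2) w(1) gsc Gval[OF w(1)]
      by (simp add: G.word_val_append G.word_val_inv flip: p_def)
    then have "word_val H hs ?u \<in> generate H (word_val H hs ` R)"
      by (rule Rgen[OF lhs hsc up])
    then have y1: "word_val H hs ?u \<otimes>\<^bsub>H\<^esub> y0 \<in> seeds" using stable y0 by blast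
    have y0c: "y0 \<in> carrier H" "\<chi>' y0 = \<chi> \<one>\<^bsub>G\<^esub>" using y0 by (simp_all add: seeds_def)
    have "word_val H hs ?u = inv\<^bsub>H\<^esub> (word_val H hs v)"
      using v(1) w hsc lhs Hval[OF v(1)] by (simp add: H.word_val_append H.word_val_inv)
    then have "word_val H hs v \<otimes>\<^bsub>H\<^esub> (word_val H hs ?u \<otimes>\<^bsub>H\<^esub> y0) = y0"
      using Hval[OF v(1)] y0c(1) by (simp add: H.mult_inv_cancel)
    then have "block (word_val G gs w) = block \<one>\<^bsub>G\<^esub>"
      using v(3)[OF y1] y0c(2) by (simp add: \<chi>_def)
    also have "block \<one>\<^bsub>G\<^esub> = {\<one>\<^bsub>G\<^esub>}" by (rule block_eq[OF P(4)]) simp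
    finally show ?thesis using block(2)[OF Gval[OF w(1)]] by simp
  qed
  have well: "word_val G gs v = word_val G gs w"
    if v: "v \<in> words p" and w: "w \<in> words p" and eq: "word_val H hs v = word_val H hs w" for v w
  proof -
    have "word_val H hs (word_inv v @ w) = \<one>\<^bsub>H\<^esub>"
      using v w eq hsc lhs Hval[OF w] by (simp add: H.word_val_append H.word_val_inv)
    then have "word_val G gs (word_inv v @ w) = \<one>\<^bsub>G\<^esub>" using v w by (intro rel) simp_all
    then have "inv\<^bsub>G\<^esub> (word_val G gs v) \<otimes>\<^bsub>G\<^esub> word_val G gs w = \<one>\<^bsub>G\<^esub>"
      using v w gsc by (simp add: p_def G.word_val_append G.word_val_inv)
    then show ?thesis
      using G.inv_solve_left'[OF G.one_closed Gval[OF v] Gval[OF w]] Gval[OF v] by simp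
  qed
  have surjH: "carrier H = word_val H hs ` words p"
    using H.generate_eq_word_val[OF hsc] hsg lhs by simp
  \<comment> \<open>By \<open>well\<close>, the value does not depend on the word chosen for
    \<open>y\<close>.\<close>
  define \<phi> where "\<phi> y = word_val G gs (SOME w. w \<in> words p \<and> word_val H hs w = y)" for y
  have \<phi>: "\<phi> (word_val H hs w) = word_val G gs w" if w: "w \<in> words p" for w
  proof -
    have "\<exists>v. v \<in> words p \<and> word_val H hs v = word_val H hs w" using w by blast
    from someI_ex[OF this] show ?thesis unfolding \<phi>_def by (intro well w) simp_all
  qed
  show thesis
  proof (rule that)
    show "\<phi> \<in> hom H G"
    proof (rule homI)
      fix x y assume "x \<in> carrier H" "y \<in> carrier H"
      then obtain v w where vw: "v \<in> words p" "x = word_val H hs v" "w \<in> words p" "y = word_val H hs w"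
        unfolding surjH by blast
      then show "\<phi> x \<in> carrier G" using \<phi> Gval by simp
      have "x \<otimes>\<^bsub>H\<^esub> y = word_val H hs (v @ w)"
        using vw hsc lhs by (simp add: H.word_val_append)
      then have "\<phi> (x \<otimes>\<^bsub>H\<^esub> y) = word_val G gs (v @ w)" using \<phi>[of "v @ w"] vw by simp
      also have "\<dots> = \<phi> x \<otimes>\<^bsub>G\<^esub> \<phi> y"
        using vw gsc by (simp add: \<phi> G.word_val_append flip: p_def)
      finally show "\<phi> (x \<otimes>\<^bsub>H\<^esub> y) = \<phi> x \<otimes>\<^bsub>G\<^esub> \<phi> y" .
    qed
    have "\<phi> ` carrier H = word_val G gs ` words p"
      unfolding surjH image_image using \<phi> by (intro image_cong) simp_all
    also have "\<dots> = carrier G"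
      using G.generate_eq_word_val[OF gsc] gsg by (simp add: p_def generating_seq_def)
    finally show "\<phi> ` carrier H = carrier G" .
  qed
qed

lemma (in group) commutators_central_of_class2:
  assumes "lower_central G 2 = {\<one>}"
  shows "commutators_central G"
  unfolding commutators_central_def
proof (intro ballI)
  fix x y assume x: "x \<in> carrier G" and y: "y \<in> carrier G"
  let ?c = "x \<otimes> y \<otimes> inv x \<otimes> inv y"
  have cc: "?c \<in> carrier G" using x y by simp
  have c: "?c \<in> lower_central G 1"
    using x y by (auto intro!: generate.incl)
  have "?c \<otimes> z = z \<otimes> ?c" if z: "z \<in> carrier G" for z
  proof -
    have "?c \<otimes> z \<otimes> inv ?c \<otimes> inv z \<in> lower_central G (Suc 1)"
      unfolding lower_central.simps(2)[of G 1] using c z by (intro generate.incl) blast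
    then have "?c \<otimes> z \<otimes> inv ?c \<otimes> inv z = \<one>" using assms by (simp add: numeral_2_eq_2)
    then have "?c \<otimes> z \<otimes> inv ?c = z"
      using cc z by (metis inv_equality inv_inv inv_closed m_closed)
    then have "?c \<otimes> z \<otimes> inv ?c \<otimes> ?c = z \<otimes> ?c" by simp
    then show ?thesis using cc z by (simp add: m_assoc del: r_inv)
  qed
  with cc show "?c \<in> center_set G" by (simp add: center_set_def)
qed

theorem theorem2p7:
  fixes G :: "('a, 'b) monoid_scheme" and H :: "('c, 'd) monoid_scheme"
    and n m :: nat
  assumes "n > 0" and "m > 0"
    and "class_I n m G"
    and "group H" and "finitely_generated H"
    and "configuration_equivalent G H"
    and "(n = 3 \<and> m = 2) \<or> (n = 3 \<and> m = 3) \<or> m = 1"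
  shows "G \<cong> H"
proof -
  have G: "group G" and fgG: "finitely_generated G" and "lower_central G 2 = {\<one>\<^bsub>G\<^esub>}"
    using assms(3) by (simp_all add: class_I_def nilpotent_of_class_def)
  then have cG: "commutators_central G" by (intro group.commutators_central_of_class2)
  have Con: "Con G = Con H" using assms(6) by (simp add: configuration_equivalent_def)
  have cH: "commutators_central H"
    by (rule commutators_central_transfer[OF G assms(4) cG assms(5)]) (simp add: Con)
  obtain gs where gs: "cyclic_series G gs (carrier G)"
    using fgG group.cyclic_series_class2[OF G cG] finite_list unfolding finitely_generated_def
    by metis
  obtain hs where hs: "cyclic_series H hs (carrier H)"
    using assms(5) group.cyclic_series_class2[OF assms(4) cH] finite_list
    unfolding finitely_generated_def by metis
  obtain \<phi> where \<phi>: "\<phi> \<in> hom H G" "\<phi> ` carrier H = carrier G"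
    by (rule epimorphism_from_Con_subset[OF G assms(4) gs cH]) (simp_all add: Con)
  obtain \<psi> where \<psi>: "\<psi> \<in> hom G H" "\<psi> ` carrier G = carrier H"
    by (rule epimorphism_from_Con_subset[OF assms(4) G hs cG]) (simp_all add: Con)
  \<comment> \<open>A surjective endomorphism of \<open>G\<close> is injective, and injectivity of
    the composition passes to its first factor \<psi>.\<close>
  have "\<phi> \<circ> \<psi> \<in> hom G G" using \<psi>(1) \<phi>(1) by (rule Group.hom_compose)
  moreover have "(\<phi> \<circ> \<psi>) ` carrier G = carrier G" unfolding image_comp[symmetric] \<psi>(2) by (rule \<phi>(2))
  ultimately have "inj_on (\<phi> \<circ> \<psi>) (carrier G)"
    by (rule group.surjective_endomorphism_inj[OF G gs])
  then have "inj_on \<psi> (carrier G)" by (rule inj_on_imageI2)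
  with \<psi> have "\<psi> \<in> iso G H" by (simp add: iso_def bij_betw_def)
  then show ?thesis by (rule is_isoI)
qed

end
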